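(* Let $M$ be a positive integer such that $M+1$ is congruent to $2$ or $3$ modulo $5$, let $N\ge 1$ and $k\ge 0$ be integers. The number of partitions of $N$ into parts congruent to $2$ or $3$ modulo $5$ in which the part $M+1$ occurs exactly $k$ times is equal to the number of partitions $\lambda\in \mathsf{Diff_2}^*$ of $N$ such that one of the following holds: (1) $\lambda$ consists of exactly one part, and its size $N$ satisfies $N=(M+1)k$ or $N=(M+1)k+i$ for some $i$ with $2\le i\le M$ or $i=M+2$; (2) $\lambda$ has between $2$ and $M$ parts (inclusive), and the number of $1$'s in $col^*(\lambda)$ is between $(M+1)k$ and $(M+1)k+M$ (inclusive); (3) $\lambda$ has at least $M+1$ parts, and $col^*(\lambda)$ has exactly $k$ parts equal to $M+1$.
   Context: Partitions are written with weakly decreasing positive parts. $\mathsf{Diff_2}$ is the set of partitions $\lambda=(\lambda_1,\dots,\lambda_m)$ whose consecutive differences are at least two, i.e. $\lambda_i-\lambda_{i+1}\ge 2$ for $1\le i<m$. $\mathsf{Diff_2}^*$ is the subset of those partitions in $\mathsf{Diff_2}$ with no part equal to $1$. For $\lambda=(\lambda_1,\dots,\lambda_m)\in\mathsf{Diff_2}^*$, $col^*(\lambda)$ is the partition formed by the columns of (i.e. the conjugate of) $(\lambda_1-2m,\lambda_2-2(m-1),\dots,\lambda_m-2)$, where zero entries are ignored. Example: $col^*((13,10,6,4))=(5,4,2,2)^T=(4,4,2,2,1)$. *)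

theory Defs
  imports "HOL-Number_Theory.Cong"
begin

definition partition_of :: "nat \<Rightarrow> nat list \<Rightarrow> bool" where
  "partition_of N xs \<longleftrightarrow>
     sorted_wrt (\<ge>) xs \<and> (\<forall>x\<in>set xs. 0 < x) \<and> sum_list xs = N"

definition is_partition :: "nat list \<Rightarrow> bool" where
  "is_partition xs \<longleftrightarrow> partition_of (sum_list xs) xs"

definition Diff2 :: "nat list set" where
  "Diff2 = {xs. is_partition xs \<and>
     (\<forall>i. Suc i < length xs \<longrightarrow> int (xs ! i) - int (xs ! Suc i) \<ge> 2)}"

definition Diff2_star :: "nat list set" where
  "Diff2_star = {xs \<in> Diff2. 1 \<notin> set xs}"

text \<open>
  Column lengths of the Young diagram with row lengths \<open>xs\<close>, from left to right:
  the \<open>j\<close>-th column has one cell for every row of length at least \<open>j\<close>.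
\<close>
definition conjugate :: "nat list \<Rightarrow> nat list" where
  "conjugate xs =
     map (\<lambda>j. length (filter (\<lambda>x. j \<le> x) xs)) [1..<Suc (case xs of [] \<Rightarrow> 0 | x # _ \<Rightarrow> x)]"

text \<open>
  List positions start at \<open>0\<close>, so position \<open>i\<close> holds the part with index \<open>i + 1\<close>, from which
  \<open>2 (m - i)\<close> is subtracted, \<open>m\<close> being the number of parts. On \<open>Diff2_star\<close> this never
  truncates: see \<open>Diff2_star_nth_ge\<close> below.
\<close>
definition col_star :: "nat list \<Rightarrow> nat list" where
  "col_star xs =
     conjugate (filter (\<lambda>x. x \<noteq> 0)
       (map (\<lambda>i. xs ! i - 2 * (length xs - i)) [0..<length xs]))"

lemma Diff2_star_nth_ge:
  assumes "xs \<in> Diff2_star" "i < length xs"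
  shows "2 * (length xs - i) \<le> xs ! i"
  using assms(2)
proof (induction "length xs - Suc i" arbitrary: i)
  case 0
  have "xs ! i \<in> set xs" using 0 by simp
  with assms(1) have "0 < xs ! i" "xs ! i \<noteq> 1"
    by (auto simp: Diff2_star_def Diff2_def is_partition_def partition_of_def)
  with 0 show ?case by linarith
next
  case (Suc n)
  then have "2 * (length xs - Suc i) \<le> xs ! Suc i" by simp
  moreover have "int (xs ! i) - int (xs ! Suc i) \<ge> 2"
    using assms(1) Suc(2) by (auto simp: Diff2_star_def Diff2_def)
  ultimately show ?case by linarith
qed

lemma finite_partition_of: "finite {xs. partition_of N xs}"
proof (rule finite_subset)
  have "length xs \<le> sum_list xs" if "\<forall>x\<in>set xs. 0 < x" for xs :: "nat list"
    using that by (induction xs) auto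
  then show "{xs. partition_of N xs} \<subseteq> {xs. set xs \<subseteq> {..N} \<and> length xs \<le> N}"
    by (auto simp: partition_of_def dest: member_le_sum_list)
  show "finite {xs. set xs \<subseteq> {..N} \<and> length xs \<le> N}"
    by (rule finite_lists_length_le) simp
qed

lemma "col_star [13, 10, 6, 4] = conjugate [5, 4, 2, 2]"
  by (simp add: col_star_def upt_rec)

lemma "conjugate [5, 4, 2, 2] = [4, 4, 2, 2, 1]"
  by (simp add: conjugate_def upt_rec)

end

(*
  Summing over the number m of parts, subtracting the staircase 2m, 2(m-1), ..., 2 from a partition
  in Diff2_star leaves an arbitrary partition with at most m parts, whose columns form an arbitrary
  partition with parts at most m. Fixing the multiplicity of the column M + 1 (if m > M), or
  confining the multiplicity of the column 1 to M + 1 consecutive values (if m <= M), both turn the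
  generating function X^(m^2+m) / (X;X)_m into X^((M+1)k) (1 - X^(M+1)) X^(m^2+m) / (X;X)_m.
  The case m = 1 of the theorem stands for the sum of the terms m = 0 and m = 1. Hence the claim is
  the second Rogers-Ramanujan identity multiplied by X^((M+1)k) (1 - X^(M+1)).

  The Rogers-Ramanujan identity is obtained from a finite version: both
  sum_j q^(j^2+j) [n,j] and sum_j (-1)^j q^(j(5j+3)/2) [2n+1,n+1+2j] satisfy, together with a
  companion sequence, the same first-order recurrence system. Modulo X^(L+1) the Gaussian binomials
  become constant for large n, and the alternating sum is evaluated by a finite form of the
  Jacobi triple product.
*)
theory Submission
  imports Defs "HOL-Computational_Algebra.Computational_Algebra"
begin

section \<open>Gaussian binomial coefficients\<close>

text \<open>
  The lower index is an integer, so that alternating sums can be shifted and reflected freely;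
  for negative \<open>k\<close> the truncation in \<open>nat k\<close> is harmless, since \<open>qbin q n k\<close> vanishes there.
\<close>

fun qbin :: "'a::comm_ring_1 \<Rightarrow> nat \<Rightarrow> int \<Rightarrow> 'a" where
  "qbin q 0 k = (if k = 0 then 1 else 0)"
| "qbin q (Suc n) k = qbin q n (k - 1) + q ^ nat k * qbin q n k"

lemma qbin_eq_0: "k < 0 \<or> int n < k \<Longrightarrow> qbin q n k = 0"
  by (induction n arbitrary: k) (auto simp: qbin.simps(2))

lemmas [simp del] = qbin.simps(2)

text \<open>For negative \<open>k\<close> both binomials vanish, so the truncated exponent may be
  replaced by an integer one. This makes all later exponent arithmetic uniform in the sign.\<close>

lemma qbin_pascal1:
  fixes q :: "'a::field"
  shows "qbin q (Suc n) k = qbin q n (k - 1) + q powi k * qbin q n k"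
  by (cases "k \<ge> 0") (auto simp: qbin_eq_0 qbin.simps(2) power_int_def)

text \<open>Expand by the first Pascal rule, apply the induction hypothesis to both terms, and
  regroup: the two mixed products of powers are both q^(n+1).\<close>

lemma qbin_pascal2:
  fixes q :: "'a::field"
  assumes "q \<noteq> 0"
  shows "qbin q (Suc n) k = q powi (int n + 1 - k) * qbin q n (k - 1) + qbin q n k"
proof (induction n arbitrary: k)
  case 0
  then show ?case by (auto simp: qbin.simps(2) assms)
next
  case (Suc n)
  have 1: "q powi k * q powi (int n + 1 - k) = q powi (int n + 1)"
    by (simp add: power_int_add[symmetric] assms)
  have 2: "q powi (int n + 2 - k) * q powi (k - 1) = q powi (int n + 1)"
    by (simp add: power_int_add[symmetric] assms)
  have "qbin q (Suc (Suc n)) k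
    = q powi (int n + 2 - k) * qbin q n (k - 2) + qbin q n (k - 1)
      + (q powi k * q powi (int n + 1 - k)) * qbin q n (k - 1) + q powi k * qbin q n k"
    unfolding qbin_pascal1[of q "Suc n"] by (subst (1 2) Suc.IH) (simp add: algebra_simps)
  also have "\<dots> = q powi (int n + 2 - k) * (qbin q n (k - 2) + q powi (k - 1) * qbin q n (k - 1))
      + (qbin q n (k - 1) + q powi k * qbin q n k)"
    unfolding 1 2[symmetric] by (simp add: algebra_simps)
  also have "\<dots> = q powi (int (Suc n) + 1 - k) * qbin q (Suc n) (k - 1) + qbin q (Suc n) k"
    unfolding qbin_pascal1[of q n] by (simp add: algebra_simps)
  finally show ?case .
qed

text \<open>Reflecting the lower index exchanges the two Pascal rules.\<close>

lemma qbin_sym: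
  fixes q :: "'a::field"
  assumes "q \<noteq> 0" "j + k = int n"
  shows "qbin q n j = qbin q n k"
  using assms(2)
proof (induction n arbitrary: j k)
  case (Suc n)
  have "qbin q (Suc n) j = qbin q n (j - 1) + q powi j * qbin q n j"
    by (rule qbin_pascal1)
  also have "\<dots> = qbin q n k + q powi (int n + 1 - k) * qbin q n (k - 1)"
  proof -
    have j: "j = int n + 1 - k" using Suc.prems by simp
    then have "qbin q n (j - 1) = qbin q n k" "qbin q n j = qbin q n (k - 1)"
      by (auto intro!: Suc.IH)
    then show ?thesis by (simp add: j)
  qed
  also have "\<dots> = qbin q (Suc n) k" unfolding qbin_pascal2[OF assms(1)] by simp
  finally show ?case .
qed auto

text \<open>Eliminate \<open>qbin q n (k - 1)\<close> between the two Pascal rules.\<close>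

lemma qbin_absorb:
  fixes q :: "'a::field"
  assumes "q \<noteq> 0"
  shows "(1 - q powi (int n + 1 - k)) * qbin q (Suc n) k = (1 - q ^ Suc n) * qbin q n k"
proof -
  have a: "q powi (int n + 1 - k) * q powi k = q ^ Suc n"
    using power_int_of_nat[of q "Suc n"] by (simp add: power_int_add[symmetric] assms add.commute)
  have "qbin q (Suc n) k - q powi (int n + 1 - k) * qbin q (Suc n) k
     = q powi (int n + 1 - k) * qbin q n (k - 1) + qbin q n k
       - q powi (int n + 1 - k) * (qbin q n (k - 1) + q powi k * qbin q n k)"
    by (subst qbin_pascal2[OF assms], subst qbin_pascal1) simp
  also have "\<dots> = qbin q n k - (q powi (int n + 1 - k) * q powi k) * qbin q n k"
    by (simp add: algebra_simps)
  finally show ?thesis unfolding a by (simp add: algebra_simps)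
qed

text \<open>The division is exact for every integer. The theta exponents j(5j+1)/2 and j(5j+3)/2
  below appear as \<open>5 * tri j + 3 * j\<close> and \<open>5 * tri j + 4 * j\<close>, which keeps
  them free of division.\<close>

definition tri :: "int \<Rightarrow> int" where "tri j = j * (j - 1) div 2"

lemma tri_double: "2 * tri j = j * (j - 1)"
  by (simp add: tri_def)

lemma tri_minus: "tri (- j) = tri j + j"
  using tri_double[of j] tri_double[of "-j"] by (simp add: algebra_simps)

lemma tri_reflect: "tri (- 1 - j) = tri j + 2 * j + 1"
  using tri_double[of j] tri_double[of "-1-j"] by (simp add: algebra_simps)

lemma tri_pred: "tri (j - 1) = tri j - j + 1"
  using tri_double[of j] tri_double[of "j-1"] by (simp add: algebra_simps)

definition sg :: "int \<Rightarrow> 'a::comm_ring_1" where "sg j = (if even j then 1 else -1)"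

section \<open>Reindexing sums over a range of integers\<close>

lemma sum_int_flip:
  fixes f :: "int \<Rightarrow> 'a::comm_monoid_add" and K :: int
  assumes "f (- K - 1) = 0" "f (K + 1) = 0" "K \<ge> 0"
  shows "(\<Sum>j\<in>{-K-1..K}. f (- j)) = (\<Sum>j\<in>{-K-1..K}. f j)"
proof -
  have "(\<Sum>j\<in>{-K-1..K}. f (- j)) = (\<Sum>j\<in>{-K..K+1}. f j)"
    by (rule sum.reindex_bij_witness[of _ uminus uminus]) auto
  also have "{-K..K+1} = insert (K + 1) {-K..K}" using assms(3) by auto
  also have "sum f \<dots> = sum f {-K..K}" using assms by simp
  also have "\<dots> = sum f (insert (-K-1) {-K..K})" using assms by simp
  also have "insert (-K-1) {-K..K} = {-K-1..K}" using assms(3) by auto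
  finally show ?thesis .
qed

text \<open>The reflection j -> -1-j exchanges the negative and the nonnegative half of the range,
  so the halves cancel. No division by 2 occurs, hence the characteristic does not matter.\<close>

lemma sum_int_antisym:
  fixes f :: "int \<Rightarrow> 'a::ab_group_add" and K :: int
  assumes "\<And>j. f (- 1 - j) = - f j" "K \<ge> 0"
  shows "(\<Sum>j\<in>{-K-1..K}. f j) = 0"
proof -
  have "{-K-1..K} = {-K-1..-1} \<union> {0..K}" using assms(2) by auto
  then have "(\<Sum>j\<in>{-K-1..K}. f j) = (\<Sum>j\<in>{-K-1..-1}. f j) + (\<Sum>j\<in>{0..K}. f j)"
    by (simp add: sum.union_disjoint)
  also have "(\<Sum>j\<in>{-K-1..-1}. f j) = (\<Sum>j\<in>{0..K}. f (- 1 - j))"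
    by (rule sum.reindex_bij_witness[of _ "\<lambda>j. - 1 - j" "\<lambda>j. - 1 - j"]) auto
  finally show ?thesis by (simp add: assms sum_negf)
qed

lemma sum_int_shift:
  fixes f :: "int \<Rightarrow> 'a::comm_monoid_add" and K :: int
  assumes "f (- K - 2) = 0" "f K = 0" "K \<ge> 0"
  shows "(\<Sum>j\<in>{-K-1..K}. f (j - 1)) = (\<Sum>j\<in>{-K-1..K}. f j)"
proof -
  have "(\<Sum>j\<in>{-K-1..K}. f (j - 1)) = (\<Sum>j\<in>{-K-2..K-1}. f j)"
    by (rule sum.reindex_bij_witness[of _ "\<lambda>j. j + 1" "\<lambda>j. j - 1"]) auto
  also have "{-K-2..K-1} = insert (-K-2) {-K-1..K-1}" using assms(3) by auto
  also have "sum f \<dots> = sum f {-K-1..K-1}" using assms by simp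
  also have "\<dots> = sum f (insert K {-K-1..K-1})" using assms by simp
  also have "insert K {-K-1..K-1} = {-K-1..K}" using assms(3) by auto
  finally show ?thesis .
qed

section \<open>A finite Rogers-Ramanujan identity\<close>

text \<open>
  Any cut-off \<open>K \<ge> n\<close> captures the whole support of the sums below; the summation range is
  invariant under \<open>j \<mapsto> - 1 - j\<close> and is kept independent of \<open>n\<close> for the recurrences.
\<close>

definition schur_even :: "'a::field \<Rightarrow> nat \<Rightarrow> nat \<Rightarrow> 'a" where
  "schur_even q K n = (\<Sum>j\<in>{-int K-1..int K}. sg j * q powi (5 * tri j + 3 * j) * qbin q (2 * n) (int n + 2 * j))"

definition schur_odd :: "'a::field \<Rightarrow> nat \<Rightarrow> nat \<Rightarrow> 'a" where
  "schur_odd q K n = (\<Sum>j\<in>{-int K-1..int K}. sg j * q powi (5 * tri j + 4 * j) * qbin q (2 * n + 1) (int n + 1 + 2 * j))"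

lemma sg_simps [simp]: "sg (- j) = sg j" "sg (- 1 - j) = - sg j" "sg (j - 1) = - sg j" "sg 0 = 1"
  by (auto simp: sg_def)

lemma qpi_combine:
  fixes q :: "'a::field"
  assumes "q \<noteq> 0"
  shows "q powi a * q powi b = q powi (a + b)" "q powi a * (q powi b * x) = q powi (a + b) * x"
  using assms by (simp_all add: power_int_add mult.assoc)

text \<open>Pascal expansion leaves, besides \<open>schur_even q K n\<close>, the families
  \<open>a\<close>, \<open>c\<close>, \<open>d\<close> on the left and \<open>b\<close>,
  \<open>e\<close> on the right. Negating j carries \<open>a\<close> to \<open>b\<close> and
  \<open>d\<close> to \<open>e\<close>, while \<open>c\<close> changes sign under j -> -1-j and sums
  to zero.\<close>

lemma schur_even_rec:
  fixes q :: "'a::field"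
  assumes q: "q \<noteq> 0" and K: "K \<ge> n + 1"
  shows "schur_even q K (Suc n) = schur_even q K n + q ^ Suc n * schur_odd q K n"
proof -
  let ?I = "{-int K-1..int K}"
  let ?B = "\<lambda>i. qbin q (2 * n) (int n + i)"
  define a where "a j = sg j * q powi (int n + 1 + 5 * tri j + j) * ?B (2 * j - 1)" for j
  define b where "b j = sg j * q powi (int n + 1 + 5 * tri j + 4 * j) * ?B (2 * j + 1)" for j
  define c where "c j = sg j * q powi (int n + 1 + 5 * tri j + 5 * j) * ?B (2 * j + 1)" for j
  define d where "d j = sg j * q powi (2 * int n + 1 + 5 * tri j + 3 * j) * ?B (2 * j)" for j
  define e where "e j = sg j * q powi (2 * int n + 1 + 5 * tri j + 2 * j) * ?B (2 * j)" for j
  have p1: "qbin q (2 * n + 1) (int n + 2 * j) = q powi (int n + 1 - 2 * j) * ?B (2 * j - 1) + ?B (2 * j)" for j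
    using qbin_pascal2[OF q, of "2 * n" "int n + 2 * j"] by (simp add: algebra_simps)
  have p2: "qbin q (2 * n + 1) (int n + 1 + 2 * j) = q powi (int n - 2 * j) * ?B (2 * j) + ?B (2 * j + 1)" for j
    using qbin_pascal2[OF q, of "2 * n" "int n + 1 + 2 * j"] by (simp add: algebra_simps)
  have p3: "qbin q (2 * Suc n) (int (Suc n) + 2 * j) = qbin q (2 * n + 1) (int n + 2 * j)
      + q powi (int n + 1 + 2 * j) * qbin q (2 * n + 1) (int n + 1 + 2 * j)" for j
    using qbin_pascal1[of q "2 * n + 1" "int n + 1 + 2 * j"] by (simp add: algebra_simps)
  have qn: "q ^ Suc n = q powi (int n + 1)"
    using power_int_of_nat[of q "Suc n"] by (simp add: add.commute)
  have term1: "sg j * q powi (5 * tri j + 3 * j) * qbin q (2 * Suc n) (int (Suc n) + 2 * j)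
     = sg j * q powi (5 * tri j + 3 * j) * ?B (2 * j) + (a j + (d j + c j))" for j
    unfolding p3 p1 p2 a_def c_def d_def
    by (simp add: ring_distribs mult.assoc mult.left_commute[of "q powi _" "sg _"] qpi_combine[OF q])
       (simp add: algebra_simps)
  have term2: "q ^ Suc n * (sg j * q powi (5 * tri j + 4 * j) * qbin q (2 * n + 1) (int n + 1 + 2 * j)) = e j + b j" for j
    unfolding p2 qn e_def b_def
    by (simp add: ring_distribs mult.assoc mult.left_commute[of "q powi _" "sg _"] qpi_combine[OF q])
       (simp add: algebra_simps)
  have "sum a ?I = (\<Sum>j\<in>?I. b (- j))"
  proof (rule sum.cong)
    fix j show "a j = b (- j)"
      using qbin_sym[OF q, of "int n + (2 * j - 1)" "int n + (- 2 * j + 1)" "2 * n"]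
      by (simp add: a_def b_def tri_minus algebra_simps)
  qed simp
  also have "\<dots> = sum b ?I"
    by (rule sum_int_flip) (use K in \<open>auto simp: b_def qbin_eq_0\<close>)
  finally have ab: "sum a ?I = sum b ?I" .
  have "sum d ?I = (\<Sum>j\<in>?I. e (- j))"
  proof (rule sum.cong)
    fix j show "d j = e (- j)"
      using qbin_sym[OF q, of "int n + 2 * j" "int n - 2 * j" "2 * n"]
      by (simp add: d_def e_def tri_minus algebra_simps)
  qed simp
  also have "\<dots> = sum e ?I"
    by (rule sum_int_flip) (use K in \<open>auto simp: e_def qbin_eq_0\<close>)
  finally have de: "sum d ?I = sum e ?I" .
  have "sum c ?I = 0"
  proof (rule sum_int_antisym)
    \<comment> \<open>The reflection preserves both the exponent of q and, by symmetry, the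
      binomial; only \<open>sg\<close> changes sign.\<close>
    fix j show "c (- 1 - j) = - c j"
      using qbin_sym[OF q, of "int n + (2 * j + 1)" "int n + (2 * (- 1 - j) + 1)" "2 * n"]
      by (simp add: c_def tri_reflect algebra_simps)
  qed simp
  then show ?thesis
    unfolding schur_even_def schur_odd_def sum_distrib_left term1 term2
    by (simp add: sum.distrib ab de)
qed

text \<open>Same method: \<open>a\<close> and \<open>b\<close> match under negation of j, and the
  remainder \<open>c\<close> is antisymmetric under j -> -1-j.\<close>

lemma schur_odd_rec:
  fixes q :: "'a::field"
  assumes q: "q \<noteq> 0" and K: "K \<ge> n + 1"
  shows "schur_odd q K (Suc n) = q ^ Suc n * schur_even q K (Suc n) + (1 - q ^ Suc n) * schur_odd q K n"
proof -
  let ?I = "{-int K-1..int K}"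
  let ?B = "\<lambda>i. qbin q (2 * n + 1) (int n + i)"
  let ?C = "\<lambda>i. qbin q (2 * n + 2) (int n + 1 + i)"
  define a where "a j = sg j * q powi (int n + 1 + 5 * tri j + 2 * j) * ?C (2 * j)" for j
  define b where "b j = sg j * q powi (int n + 1 + 5 * tri j + 3 * j) * ?C (2 * j)" for j
  \<comment> \<open>The summand with \<open>?B (2 * j + 1)\<close> is added here and subtracted
    through the factor 1 - q^(n+1). It completes the remainder to an antisymmetric family: the
    reflection swaps the two binomials.\<close>
  define c where "c j = sg j * q powi (int n + 1 + 5 * tri j + 4 * j) * (q powi (1 + 2 * j) * ?B (2 * j + 2) + ?B (2 * j + 1))" for j
  have p2: "qbin q (2 * n + 3) (int n + 2 + 2 * j) = q powi (int n + 1 - 2 * j) * ?C (2 * j) + ?C (2 * j + 1)" for j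
    using qbin_pascal2[OF q, of "2 * n + 2" "int n + 2 + 2 * j"] by (simp add: algebra_simps numeral_3_eq_3)
  have p1: "?C (2 * j + 1) = ?B (2 * j + 1) + q powi (int n + 2 + 2 * j) * ?B (2 * j + 2)" for j
    using qbin_pascal1[of q "2 * n + 1" "int n + 2 + 2 * j"] by (simp add: algebra_simps)
  have qn: "q ^ Suc n = q powi (int n + 1)"
    using power_int_of_nat[of q "Suc n"] by (simp add: add.commute)
  have t1: "sg j * q powi (5 * tri j + 4 * j) * qbin q (2 * Suc n + 1) (int (Suc n) + 1 + 2 * j)
     = a j + (1 - q powi (int n + 1)) * (sg j * q powi (5 * tri j + 4 * j) * qbin q (2 * n + 1) (int n + 1 + 2 * j)) + c j" for j
  proof -
    have "sg j * q powi (5 * tri j + 4 * j) * qbin q (2 * Suc n + 1) (int (Suc n) + 1 + 2 * j)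
      = sg j * q powi (5 * tri j + 4 * j) * (q powi (int n + 1 - 2 * j) * ?C (2 * j)
          + (?B (2 * j + 1) + q powi (int n + 2 + 2 * j) * ?B (2 * j + 2)))"
      using p2[of j] unfolding p1 by (simp add: algebra_simps numeral_3_eq_3)
    also have "\<dots> = a j + (1 - q powi (int n + 1)) * (sg j * q powi (5 * tri j + 4 * j) * qbin q (2 * n + 1) (int n + 1 + 2 * j)) + c j"
      unfolding a_def c_def
      by (simp add: ring_distribs mult.assoc mult.left_commute[of "q powi _" "sg _"] qpi_combine[OF q])
         (simp add: algebra_simps)
    finally show ?thesis .
  qed
  have t2: "q powi (int n + 1) * (sg j * q powi (5 * tri j + 3 * j) * qbin q (2 * Suc n) (int (Suc n) + 2 * j)) = b j" for j
    unfolding b_def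
    by (simp add: mult.assoc mult.left_commute[of "q powi _" "sg _"] qpi_combine[OF q])
       (simp add: algebra_simps)
  have "sum a ?I = (\<Sum>j\<in>?I. b (- j))"
  proof (rule sum.cong)
    fix j show "a j = b (- j)"
      using qbin_sym[OF q, of "int n + 1 + 2 * j" "int n + 1 - 2 * j" "2 * n + 2"]
      by (simp add: a_def b_def tri_minus algebra_simps)
  qed simp
  also have "\<dots> = sum b ?I"
    by (rule sum_int_flip) (use K in \<open>auto simp: b_def qbin_eq_0\<close>)
  finally have ab: "sum a ?I = sum b ?I" .
  have "sum c ?I = 0"
  proof (rule sum_int_antisym)
    fix j show "c (- 1 - j) = - c j"
      using qbin_sym[OF q, of "int n + (2 * j + 1)" "int n + (2 * (- 1 - j) + 2)" "2 * n + 1"]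
            qbin_sym[OF q, of "int n + (2 * j + 2)" "int n + (2 * (- 1 - j) + 1)" "2 * n + 1"]
      by (simp add: c_def tri_reflect ring_distribs mult.assoc qpi_combine[OF q])
         (simp add: algebra_simps)
  qed simp
  then show ?thesis
    unfolding schur_even_def schur_odd_def sum_distrib_left qn t1 t2
    by (simp add: sum.distrib ab)
qed

section \<open>The sum sides of the finite identities\<close>

definition fin_even :: "'a::field \<Rightarrow> nat \<Rightarrow> 'a" where
  "fin_even q n = (\<Sum>j\<le>n. q ^ (j * j) * qbin q n (int j))"

definition fin_odd :: "'a::field \<Rightarrow> nat \<Rightarrow> 'a" where
  "fin_odd q n = (\<Sum>j\<le>n. q ^ (j * j + j) * qbin q n (int j))"

text \<open>Apply the second Pascal rule and shift j in its first term; the exponents match because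
  (j+1)^2 + (n-j) = (n+1) + (j^2+j).\<close>

lemma fin_even_rec:
  fixes q :: "'a::field"
  assumes q: "q \<noteq> 0"
  shows "fin_even q (Suc n) = fin_even q n + q ^ Suc n * fin_odd q n"
proof -
  have "fin_even q (Suc n) = (\<Sum>j\<le>Suc n. q ^ (j * j) * (q powi (int n + 1 - int j) * qbin q n (int j - 1)))
      + (\<Sum>j\<le>Suc n. q ^ (j * j) * qbin q n (int j))"
    unfolding fin_even_def qbin_pascal2[OF q, of n] by (simp only: ring_distribs sum.distrib)
  also have "(\<Sum>j\<le>Suc n. q ^ (j * j) * qbin q n (int j)) = fin_even q n"
    by (simp add: fin_even_def qbin_eq_0)
  also have "(\<Sum>j\<le>Suc n. q ^ (j * j) * (q powi (int n + 1 - int j) * qbin q n (int j - 1)))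
     = (\<Sum>j\<le>n. q ^ (Suc j * Suc j) * (q powi (int n - int j) * qbin q n (int j)))"
    by (subst sum.atMost_Suc_shift) (simp add: qbin_eq_0)
  also have "\<dots> = (\<Sum>j\<le>n. q ^ Suc n * (q ^ (j * j + j) * qbin q n (int j)))"
  proof (rule sum.cong)
    fix j assume "j \<in> {..n}"
    then have "q powi (int n - int j) = q ^ (n - j)" "Suc j * Suc j + (n - j) = Suc n + (j * j + j)"
      by (auto simp flip: of_nat_diff)
    then show "q ^ (Suc j * Suc j) * (q powi (int n - int j) * qbin q n (int j))
      = q ^ Suc n * (q ^ (j * j + j) * qbin q n (int j))"
      by (metis mult.assoc power_add)
  qed simp
  finally show ?thesis by (simp add: fin_odd_def sum_distrib_left)
qed

text \<open>In the difference of the two sums on level n+1 each binomial acquires the factor 1 -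
  q^(n+1-j), and absorption lowers it to level n.\<close>

lemma fin_odd_rec:
  fixes q :: "'a::field"
  assumes q: "q \<noteq> 0"
  shows "fin_odd q (Suc n) = q ^ Suc n * fin_even q (Suc n) + (1 - q ^ Suc n) * fin_odd q n"
proof -
  have "fin_odd q (Suc n) - q ^ Suc n * fin_even q (Suc n)
     = (\<Sum>j\<le>Suc n. (q ^ (j * j + j) - q ^ Suc n * q ^ (j * j)) * qbin q (Suc n) (int j))"
    by (simp only: fin_odd_def fin_even_def sum_distrib_left sum_subtractf[symmetric] left_diff_distrib mult.assoc)
  also have "\<dots> = (\<Sum>j\<le>Suc n. (1 - q ^ Suc n) * (q ^ (j * j + j) * qbin q n (int j)))"
  proof (rule sum.cong)
    fix j assume "j \<in> {..Suc n}"
    then have 1: "q powi (int n + 1 - int j) = q ^ (Suc n - j)" "Suc n + j * j = (j * j + j) + (Suc n - j)"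
      using power_int_of_nat[of q "Suc n - j"] by (auto simp: algebra_simps of_nat_diff)
    have 2: "q ^ (j * j + j) - q ^ Suc n * q ^ (j * j) = q ^ (j * j + j) * (1 - q powi (int n + 1 - int j))"
      unfolding power_add[symmetric] 1 by (simp add: power_add algebra_simps)
    show "(q ^ (j * j + j) - q ^ Suc n * q ^ (j * j)) * qbin q (Suc n) (int j)
      = (1 - q ^ Suc n) * (q ^ (j * j + j) * qbin q n (int j))"
      unfolding 2 mult.assoc qbin_absorb[OF q] by (rule mult.left_commute)
  qed simp
  also have "\<dots> = (1 - q ^ Suc n) * fin_odd q n"
    by (simp add: fin_odd_def sum_distrib_left qbin_eq_0)
  finally show ?thesis by (simp add: algebra_simps)
qed

lemma finite_RR:
  fixes q :: "'a::field"
  assumes q: "q \<noteq> 0" and K: "n \<le> K"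
  shows "fin_even q n = schur_even q K n \<and> fin_odd q n = schur_odd q K n"
  using K
proof (induction n)
  case 0
  \<comment> \<open>For n = 0 only j = 0 survives, also in the odd sum, since 1+2j = 1 is the only
    odd index in 0..1.\<close>
  have "schur_even q K 0 = (\<Sum>j\<in>{0}. sg j * q powi (5 * tri j + 3 * j) * qbin q (2 * 0) (int 0 + 2 * j))"
    unfolding schur_even_def by (rule sum.mono_neutral_right) auto
  moreover have "schur_odd q K 0 = (\<Sum>j\<in>{0}. sg j * q powi (5 * tri j + 4 * j) * qbin q (2 * 0 + 1) (int 0 + 1 + 2 * j))"
    unfolding schur_odd_def by (rule sum.mono_neutral_right) (auto intro!: qbin_eq_0)
  ultimately show ?case by (simp add: fin_even_def fin_odd_def tri_def qbin.simps(2))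
next
  case (Suc n)
  then show ?case
    by (simp add: fin_even_rec[OF q] fin_odd_rec[OF q] schur_even_rec[OF q] schur_odd_rec[OF q] del: power_Suc)
qed

section \<open>A finite Jacobi triple product\<close>

text \<open>Two Pascal steps express the binomial on level 2n+2 by three neighbours on level 2n.
  After shifting, the sum is multiplied by 1 + q^(2n+1) - x q^n - q^(n+1)/x, which is the new factor
  of the product.\<close>

lemma finite_JTP:
  fixes q x :: "'a::field"
  assumes q: "q \<noteq> 0" and x: "x \<noteq> 0" and K: "n < K"
  shows "(\<Sum>j\<in>{-int K-1..int K}. sg j * x powi j * q powi tri j * qbin q (2 * n) (int n + j))
     = (\<Prod>i<n. (1 - x * q ^ i) * (1 - q ^ Suc i / x))"
  using K
proof (induction n)
  case 0
  have "(\<Sum>j\<in>{-int K-1..int K}. sg j * x powi j * q powi tri j * qbin q (2 * 0) (int 0 + j))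
    = (\<Sum>j\<in>{0}. sg j * x powi j * q powi tri j * qbin q (2 * 0) (int 0 + j))"
    by (rule sum.mono_neutral_right) auto
  then show ?case by (simp add: tri_def)
next
  case (Suc n)
  let ?I = "{-int K-1..int K}"
  let ?B = "\<lambda>i. qbin q (2 * n) (int n + i)"
  define f where "f j = sg j * x powi j * q powi tri j * ?B j" for j
  have p: "qbin q (2 * Suc n) (int (Suc n) + j) = (1 + q powi (2 * int n + 1)) * ?B j
     + q powi (int n + 1 - j) * ?B (j - 1) + q powi (int n + 1 + j) * ?B (j + 1)" for j
  proof -
    have "qbin q (2 * Suc n) (int (Suc n) + j)
      = qbin q (2 * n + 1) (int n + j) + q powi (int n + 1 + j) * qbin q (2 * n + 1) (int n + 1 + j)"
      using qbin_pascal1[of q "2 * n + 1" "int n + 1 + j"] by (simp add: algebra_simps)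
    moreover have "qbin q (2 * n + 1) (int n + j) = q powi (int n + 1 - j) * ?B (j - 1) + ?B j"
      using qbin_pascal2[OF q, of "2 * n" "int n + j"] by (simp add: algebra_simps)
    moreover have "qbin q (2 * n + 1) (int n + 1 + j) = q powi (int n - j) * ?B j + ?B (j + 1)"
      using qbin_pascal2[OF q, of "2 * n" "int n + 1 + j"] by (simp add: algebra_simps)
    ultimately show ?thesis
      by (simp add: ring_distribs qpi_combine[OF q])
  qed
  have q1: "q ^ Suc n = q powi (int n + 1)" "q ^ n = q powi (int n)"
    using power_int_of_nat[of q "Suc n"] by (simp_all add: add.commute)
  have x1: "x powi j = x powi (j - 1) * x" "x powi j = x powi (j + 1) / x" for j
    using x by (auto simp: power_int_add power_int_diff)
  have t: "sg j * x powi j * q powi tri j * qbin q (2 * Suc n) (int (Suc n) + j)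
    = (1 + q powi (2 * int n + 1)) * f j - x * q ^ n * f (j - 1) - q ^ Suc n / x * f (j + 1)" for j
  proof -
    have tri_succ: "tri (j + 1) = tri j + j" "tri (1 + j) = tri j + j"
      using tri_pred[of "j + 1"] by (simp_all add: add.commute)
    \<comment> \<open>The j-dependent part of each Pascal coefficient is exactly what moves
      \<open>tri j\<close> to its neighbour, leaving a factor independent of j.\<close>
    have e: "q powi tri j * q powi (int n + 1 - j) = q ^ n * q powi tri (j - 1)"
      "q powi tri j * q powi (int n + 1 + j) = q ^ Suc n * q powi tri (j + 1)"
      by (simp_all add: tri_pred tri_succ q1 qpi_combine[OF q] algebra_simps del: power_int_of_nat power_Suc)
    have s: "sg (j + 1) = (- sg j :: 'a)" by (auto simp: sg_def)
    have "sg j * x powi j * q powi tri j * (q powi (int n + 1 - j) * ?B (j - 1))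
      = sg j * x powi j * (q powi tri j * q powi (int n + 1 - j)) * ?B (j - 1)" by (simp only: mult.assoc)
    also have "\<dots> = - (x * q ^ n * f (j - 1))"
      unfolding e x1(1)[of j] f_def by (simp add: mult_ac)
    finally have 1: "sg j * x powi j * q powi tri j * (q powi (int n + 1 - j) * ?B (j - 1)) = - (x * q ^ n * f (j - 1))" .
    have "sg j * x powi j * q powi tri j * (q powi (int n + 1 + j) * ?B (j + 1))
      = sg j * x powi j * (q powi tri j * q powi (int n + 1 + j)) * ?B (j + 1)" by (simp only: mult.assoc)
    also have "\<dots> = - (q ^ Suc n / x * f (j + 1))"
      unfolding e x1(2)[of j] f_def s by (simp add: mult_ac)
    finally have 2: "sg j * x powi j * q powi tri j * (q powi (int n + 1 + j) * ?B (j + 1)) = - (q ^ Suc n / x * f (j + 1))" .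
    show ?thesis
      unfolding p distrib_left 1 2 by (simp add: f_def ring_distribs mult_ac)
  qed
  have s1: "(\<Sum>j\<in>?I. f (j - 1)) = sum f ?I"
    by (rule sum_int_shift) (use Suc.prems in \<open>auto simp: f_def qbin_eq_0\<close>)
  have s2: "(\<Sum>j\<in>?I. f (j + 1)) = sum f ?I"
  proof -
    have "sum f ?I = (\<Sum>j\<in>?I. (\<lambda>j. f (j + 1)) (j - 1))" by simp
    also have "\<dots> = (\<Sum>j\<in>?I. f (j + 1))"
      by (rule sum_int_shift) (use Suc.prems in \<open>auto simp: f_def qbin_eq_0\<close>)
    finally show ?thesis by simp
  qed
  have "(\<Sum>j\<in>?I. sg j * x powi j * q powi tri j * qbin q (2 * Suc n) (int (Suc n) + j))
    = (1 + q powi (2 * int n + 1)) * sum f ?I - x * q ^ n * sum f ?I - q ^ Suc n / x * sum f ?I"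
    unfolding t sum_subtractf sum_distrib_left[symmetric] s1 s2 ..
  also have "\<dots> = (1 - x * q ^ n) * (1 - q ^ Suc n / x) * sum f ?I"
  proof -
    \<comment> \<open>The factorization 1 + AB - A - B = (1-A)(1-B) with A = x q^n and B =
      q^(n+1)/x.\<close>
    have "q powi (2 * int n + 1) = (x * q ^ n) * (q ^ Suc n / x)"
      using x by (simp add: q1 qpi_combine[OF q] del: power_Suc power_int_of_nat)
    moreover have "(1 + A * B) * s - A * s - B * s = (1 - A) * (1 - B) * s" for A B s :: 'a
      by (simp add: algebra_simps)
    ultimately show ?thesis by metis
  qed
  finally show ?case using Suc by (simp add: f_def mult.commute)
qed

section \<open>The second Rogers-Ramanujan identity\<close>

text \<open>The Pochhammer symbol (q;q)_n.\<close>

definition qfac :: "'a::comm_ring_1 \<Rightarrow> nat \<Rightarrow> 'a" where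
  "qfac q n = (\<Prod>i<n. 1 - q ^ Suc i)"

lemma qfac_simps [simp]: "qfac q 0 = 1" "qfac q (Suc n) = qfac q n * (1 - q ^ Suc n)"
  by (simp_all add: qfac_def)

lemma qbin_self [simp]: "qbin q n (int n) = 1"
  by (induction n) (auto simp: qbin_eq_0 qbin.simps(2))

text \<open>Induction on \<open>r\<close> by absorption. The product form of the quotient formula
  avoids dividing by factors 1 - q^i, which might vanish.\<close>

lemma qfac_qbin:
  fixes q :: "'a::field"
  assumes q: "q \<noteq> 0"
  shows "qfac q m * qfac q r * qbin q (m + r) (int m) = qfac q (m + r)"
proof (induction r)
  case (Suc r)
  have "(1 - q ^ Suc r) * qbin q (Suc (m + r)) (int m) = (1 - q ^ Suc (m + r)) * qbin q (m + r) (int m)"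
    using qbin_absorb[OF q, of "m + r" "int m"] power_int_of_nat[of q "Suc r"] by (simp add: add.commute)
  then have "qfac q m * qfac q (Suc r) * qbin q (m + Suc r) (int m)
    = (qfac q m * qfac q r * qbin q (m + r) (int m)) * (1 - q ^ Suc (m + r))"
    by (simp add: mult_ac)
  also have "\<dots> = qfac q (m + Suc r)" unfolding Suc.IH by simp
  finally show ?case .
qed simp

section \<open>Transfer from Laurent series to power series\<close>

lemma fps_to_fls_prod: "fps_to_fls (prod f A) = (\<Prod>a\<in>A. fps_to_fls (f a :: 'a::comm_ring_1 fps))"
  by (induction A rule: infinite_finite_induct) (auto simp: fls_times_fps_to_fls)

lemma fps_to_fls_sum: "fps_to_fls (sum f A) = (\<Sum>a\<in>A. fps_to_fls (f a :: 'a::comm_ring_1 fps))"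
  by (induction A rule: infinite_finite_induct) auto

lemma fps_to_fls_qbin: "fps_to_fls (qbin q n k) = qbin (fps_to_fls (q :: 'a::comm_ring_1 fps)) n k"
  by (induction n arbitrary: k) (auto simp: qbin.simps(2) fls_times_fps_to_fls fps_to_fls_power)

lemma fps_to_fls_qfac: "fps_to_fls (qfac q n) = qfac (fps_to_fls (q :: 'a::comm_ring_1 fps)) n"
  by (simp add: qfac_def fps_to_fls_prod fps_to_fls_power del: power_Suc)

lemma fps_to_fls_sg: "fps_to_fls (sg j) = sg j"
  by (simp add: sg_def)

text \<open>The field version is applied in the field of Laurent series, and injectivity of the
  embedding brings the result back.\<close>

lemma qfac_qbin_fps:
  fixes q :: "'a::field fps"
  assumes q: "q \<noteq> 0"
  shows "qfac q m * qfac q r * qbin q (m + r) (int m) = qfac q (m + r)"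
proof -
  have "fps_to_fls (qfac q m * qfac q r * qbin q (m + r) (int m)) = fps_to_fls (qfac q (m + r))"
    unfolding fls_times_fps_to_fls fps_to_fls_qfac fps_to_fls_qbin
    by (rule qfac_qbin) (use q in simp)
  then show ?thesis by simp
qed

definition theta_exp :: "int \<Rightarrow> nat" where "theta_exp j = nat (5 * tri j + 4 * j)"

text \<open>From |j| <= j^2 follows j(5j+3)/2 >= |j|. So \<open>nat\<close> truncates nothing, and
  modulo X^(L+1) only terms with |j| <= L matter.\<close>

lemma theta_exp: "int (theta_exp j) = 5 * tri j + 4 * j" "nat \<bar>j\<bar> \<le> theta_exp j"
proof -
  have "\<bar>j\<bar> * 1 \<le> \<bar>j\<bar> * \<bar>j\<bar>"
    by (cases "j = 0") (use mult_left_mono[of 1 "\<bar>j\<bar>" "\<bar>j\<bar>"] in auto)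
  then have "\<bar>j\<bar> \<le> j * j" by simp
  then have "\<bar>j\<bar> \<le> 5 * tri j + 4 * j"
    using tri_double[of j] by (simp add: algebra_simps)
  then show "int (theta_exp j) = 5 * tri j + 4 * j" "nat \<bar>j\<bar> \<le> theta_exp j"
    by (auto simp: theta_exp_def)
qed

text \<open>The cut-off n+1 serves both finite identities: the triple product asks for one strictly
  above n.\<close>

abbreviation theta_range :: "nat \<Rightarrow> int set" where
  "theta_range n \<equiv> {-int (Suc n)-1..int (Suc n)}"

lemma finite_RR_fps:
  "(\<Sum>j\<le>n. fps_X ^ (j * j + j) * qbin fps_X n (int j))
   = (\<Sum>j\<in>theta_range n. sg j * fps_X ^ theta_exp j * qbin fps_X (2 * n + 1) (int n + 1 + 2 * j) :: 'a::field fps)"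
proof -
  have e: "fls_X powi (5 * tri j + 4 * j) = (fls_X :: 'a fls) ^ theta_exp j" for j
    by (simp flip: theta_exp)
  have "fin_odd (fls_X :: 'a fls) n = schur_odd fls_X (Suc n) n"
    using finite_RR[of "fls_X :: 'a fls" n "Suc n"] by simp
  then have "fps_to_fls (\<Sum>j\<le>n. fps_X ^ (j * j + j) * qbin fps_X n (int j))
   = fps_to_fls (\<Sum>j\<in>theta_range n. sg j * fps_X ^ theta_exp j * qbin fps_X (2 * n + 1) (int n + 1 + 2 * j) :: 'a fps)"
    unfolding fps_to_fls_sum fls_times_fps_to_fls fps_to_fls_qbin fps_to_fls_sg fps_to_fls_power fps_X_to_fls
      fin_odd_def schur_odd_def e .
  then show ?thesis unfolding fps_to_fls_eq_iff .
qed

text \<open>The triple product at x = X^4, q = X^5: then x^j q^(tri j) has the exponent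
  \<open>theta_exp j\<close> of the alternating Rogers-Ramanujan sum, and the factors become those
  for the residues 4 and 1 modulo 5.\<close>

lemma finite_JTP_fps:
  "(\<Sum>j\<in>theta_range n. sg j * fps_X ^ theta_exp j * qbin (fps_X ^ 5) (2 * n) (int n + j))
   = (\<Prod>i<n. (1 - fps_X ^ (5 * i + 4)) * (1 - fps_X ^ (5 * i + 1)) :: 'a::field fps)"
proof -
  let ?X = "fls_X :: 'a fls"
  have e: "sg j * (?X ^ 4) powi j * (?X ^ 5) powi tri j = sg j * ?X ^ theta_exp j" for j
  proof -
    have "?X ^ theta_exp j = ?X powi (4 * j + 5 * tri j)"
      unfolding power_int_of_nat[symmetric] theta_exp(1) by (simp only: add.commute)
    also have "\<dots> = (?X ^ 4) powi j * (?X ^ 5) powi tri j"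
      unfolding power_int_power of_nat_numeral by (rule power_int_add) simp
    finally show ?thesis by (simp only: mult.assoc)
  qed
  have f: "?X ^ 4 * (?X ^ 5) ^ i = ?X ^ (5 * i + 4)" for i
    unfolding power_mult[symmetric] power_add[symmetric] by (simp only: add.commute)
  have g: "(?X ^ 5) ^ Suc i / ?X ^ 4 = ?X ^ (5 * i + 1)" for i
  proof -
    have "(?X ^ 5) ^ Suc i = ?X ^ (5 * i + 1) * ?X ^ 4"
      unfolding power_mult[symmetric] power_add[symmetric] by (rule arg_cong[where f = "power ?X"]) simp
    then show ?thesis by (simp only:) (rule nonzero_mult_div_cancel_right, simp)
  qed
  have "(\<Sum>j\<in>theta_range n. sg j * (?X ^ 4) powi j * (?X ^ 5) powi tri j * qbin (?X ^ 5) (2 * n) (int n + j))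
     = (\<Prod>i<n. (1 - ?X ^ 4 * (?X ^ 5) ^ i) * (1 - (?X ^ 5) ^ Suc i / ?X ^ 4))"
    by (rule finite_JTP) auto
  then have "fps_to_fls (\<Sum>j\<in>theta_range n. sg j * fps_X ^ theta_exp j * qbin (fps_X ^ 5) (2 * n) (int n + j))
   = fps_to_fls (\<Prod>i<n. (1 - fps_X ^ (5 * i + 4)) * (1 - fps_X ^ (5 * i + 1)) :: 'a fps)"
    unfolding fps_to_fls_sum fps_to_fls_prod fls_times_fps_to_fls fps_to_fls_qbin fps_to_fls_sg
      fps_to_fls_minus fps_one_to_fls fps_to_fls_power fps_X_to_fls e f g .
  then show ?thesis unfolding fps_to_fls_eq_iff .
qed

section \<open>Congruence of power series modulo X^(L+1), in place of limits\<close>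

definition eqm :: "nat \<Rightarrow> 'a::comm_ring_1 fps \<Rightarrow> 'a fps \<Rightarrow> bool" where
  "eqm L a b \<longleftrightarrow> (\<forall>i\<le>L. fps_nth a i = fps_nth b i)"

lemma eqm_refl [simp]: "eqm L a a" by (simp add: eqm_def)
lemma eqm_sym: "eqm L a b \<Longrightarrow> eqm L b a" by (simp add: eqm_def)
lemma eqm_trans [trans]: "eqm L a b \<Longrightarrow> eqm L b c \<Longrightarrow> eqm L a c" by (simp add: eqm_def)

lemma eqm_mult: "eqm L a b \<Longrightarrow> eqm L c d \<Longrightarrow> eqm L (a * c) (b * d)"
  by (auto simp: eqm_def fps_mult_nth intro!: sum.cong)

lemma eqm_sum: "(\<And>x. x \<in> A \<Longrightarrow> eqm L (f x) (g x)) \<Longrightarrow> eqm L (sum f A) (sum g A)"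
  by (auto simp: eqm_def fps_sum_nth intro!: sum.cong)

lemma eqm_X_power_mult: "L < e \<Longrightarrow> eqm L (fps_X ^ e * a) (fps_X ^ e * b)"
  by (simp add: eqm_def fps_X_power_mult_nth)

lemma eqm_cancel:
  fixes u :: "'a::field fps"
  assumes "eqm L (u * a) (u * b)" "fps_nth u 0 \<noteq> 0"
  shows "eqm L a b"
proof -
  have "eqm L (inverse u * (u * a)) (inverse u * (u * b))"
    by (rule eqm_mult[OF eqm_refl assms(1)])
  moreover have "inverse u * (u * c) = c" for c
    using inverse_mult_eq_1[OF assms(2)] by (metis mult.assoc mult_1_left)
  ultimately show ?thesis by (simp only:)
qed

lemma qfac_nth_0 [simp]: "d > 0 \<Longrightarrow> fps_nth (qfac (fps_X ^ d) n :: 'a::field fps) 0 = 1"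
  by (induction n) (auto simp: fps_mult_nth_0 simp flip: power_mult power_Suc)

text \<open>Every factor beyond the L-th is 1 - X^e with e > L.\<close>

lemma qfac_eqm:
  assumes "d > 0" "L \<le> n"
  shows "eqm L (qfac (fps_X ^ d) n) (qfac (fps_X ^ d) L :: 'a::field fps)"
  using assms(2)
proof (induction n rule: dec_induct)
  case (step m)
  have "1 * Suc m \<le> d * Suc m" using assms(1) by (intro mult_right_mono) auto
  with step.hyps have "L < d * Suc m"
    by (intro less_le_trans[of L "1 * Suc m" "d * Suc m"]) auto
  then have "eqm L (1 - (fps_X ^ d) ^ Suc m) (1 :: 'a fps)"
    unfolding power_mult[symmetric] by (simp add: eqm_def del: mult_Suc_right)
  with step.IH have "eqm L (qfac (fps_X ^ d) m * (1 - (fps_X ^ d) ^ Suc m)) (qfac (fps_X ^ d) L * (1 :: 'a fps))"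
    by (rule eqm_mult)
  then show ?case by simp
qed simp

text \<open>With r = n-k >= L, both (X;X)_n and (X;X)_r agree with (X;X)_L, so (X;X)_r cancels from
  the factorial formula.\<close>

lemma qbin_eqm:
  fixes X :: "'a::field fps"
  assumes "d > 0" "X = fps_X ^ d" "int L \<le> int n - k" "0 \<le> k"
  shows "eqm L (qfac X (nat k) * qbin X n k) 1"
proof -
  define r where "r = n - nat k"
  have n: "n = nat k + r" "L \<le> r" using assms by (auto simp: r_def)
  have X: "X \<noteq> 0" using assms by simp
  have "eqm L (qfac X r * (qfac X (nat k) * qbin X n k)) (qfac X n)"
    using qfac_qbin_fps[OF X, of "nat k" r] assms(4) by (simp add: n(1) mult_ac)
  also have "eqm L (qfac X n) (qfac X L)"
    unfolding assms(2) by (rule qfac_eqm[OF assms(1)]) (use n in auto)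
  also have "eqm L \<dots> (qfac X r * 1)"
    unfolding assms(2) mult_1_right by (rule eqm_sym, rule qfac_eqm[OF assms(1)]) (use n in auto)
  finally show ?thesis
    by (rule eqm_cancel) (simp add: assms)
qed

text \<open>When the lower index is also at least L, the factor (X;X)_k becomes (X;X)_L. Being
  independent of k, it can be pulled out of a sum.\<close>

lemma qbin_eqm':
  fixes X :: "'a::field fps"
  assumes "d > 0" "X = fps_X ^ d" "int L \<le> int n - k" "int L \<le> k"
  shows "eqm L (qfac X L * qbin X n k) 1"
proof -
  have "eqm L (qfac X L * qbin X n k) (qfac X (nat k) * qbin X n k)"
    unfolding assms(2) by (intro eqm_mult eqm_refl eqm_sym[OF qfac_eqm]) (use assms in auto)
  also have "eqm L \<dots> 1" by (rule qbin_eqm) (use assms in auto)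
  finally show ?thesis .
qed

text \<open>For |j| > L both summands vanish modulo X^(L+1), so the binomial-like factor
  \<open>b j\<close> has to be controlled only for small j.\<close>

lemma theta_eqm:
  fixes b :: "int \<Rightarrow> 'a::field fps"
  assumes "\<And>j. \<bar>j\<bar> \<le> int L \<Longrightarrow> eqm L (c * b j) 1"
  shows "eqm L (c * (\<Sum>j\<in>A. sg j * fps_X ^ theta_exp j * b j)) (\<Sum>j\<in>A. sg j * fps_X ^ theta_exp j)"
  unfolding sum_distrib_left
proof (rule eqm_sum)
  fix j
  show "eqm L (c * (sg j * fps_X ^ theta_exp j * b j)) (sg j * fps_X ^ theta_exp j)"
  proof (cases "\<bar>j\<bar> \<le> int L")
    case True
    then have "eqm L ((sg j * fps_X ^ theta_exp j) * (c * b j)) ((sg j * fps_X ^ theta_exp j) * 1)"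
      by (intro eqm_mult assms eqm_refl)
    then show ?thesis by (simp add: mult_ac)
  next
    case False
    then have "L < theta_exp j" using theta_exp(2)[of j] by linarith
    from eqm_X_power_mult[OF this, of "c * sg j * b j" "sg j"] show ?thesis
      by (simp add: mult_ac)
  qed
qed

lemma prod_blocks5:
  fixes f :: "nat \<Rightarrow> 'a::comm_monoid_mult"
  shows "(\<Prod>i<5 * n. f i) = (\<Prod>i<n. f (5 * i) * f (5 * i + 1) * f (5 * i + 2) * f (5 * i + 3) * f (5 * i + 4))"
  by (induction n) (simp_all add: mult.assoc numeral_eq_Suc)

text \<open>Both (X;X)_L \<open>S\<close> and (X^5;X^5)_n \<open>P\<close> are congruent to the
  theta sum \<open>T\<close>. Sorting the factors of (X;X)_(5n) by residue modulo 5 gives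
  (X^5;X^5)_n \<open>P\<close> \<open>V\<close>, and cancelling leaves \<open>V * S\<close>
  congruent to 1. For |j| <= L the bound 4L <= n keeps every binomial index at distance at least L
  from both ends.\<close>

theorem rogers_ramanujan2:
  assumes n: "4 * L \<le> n"
  shows "eqm L ((\<Prod>i<n. (1 - fps_X ^ (5 * i + 2)) * (1 - fps_X ^ (5 * i + 3)))
            * (\<Sum>j\<le>n. fps_X ^ (j * j + j) * inverse (qfac fps_X j))) (1 :: 'a::field fps)"
proof -
  define S :: "'a fps" where "S = (\<Sum>j\<le>n. fps_X ^ (j * j + j) * inverse (qfac fps_X j))"
  define V :: "'a fps" where "V = (\<Prod>i<n. (1 - fps_X ^ (5 * i + 2)) * (1 - fps_X ^ (5 * i + 3)))"
  define P :: "'a fps" where "P = (\<Prod>i<n. (1 - fps_X ^ (5 * i + 4)) * (1 - fps_X ^ (5 * i + 1)))"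
  define T :: "'a fps" where "T = (\<Sum>j\<in>theta_range n. sg j * fps_X ^ theta_exp j)"
  have X1: "fps_X = (fps_X :: 'a fps) ^ 1" by simp
  have 1: "eqm L S (\<Sum>j\<le>n. fps_X ^ (j * j + j) * qbin fps_X n (int j))"
    unfolding S_def
  proof (rule eqm_sum)
    fix j assume j: "j \<in> {..n}"
    show "eqm L (fps_X ^ (j * j + j) * inverse (qfac fps_X j)) (fps_X ^ (j * j + j) * (qbin fps_X n (int j) :: 'a fps))"
    \<comment> \<open>For j <= L the binomial has stabilized to 1/(X;X)_j; for j > L the power of X
      exceeds L.\<close>
    proof (cases "j \<le> L")
      case True
      have "eqm L (qfac fps_X j * inverse (qfac fps_X j)) (1 :: 'a fps)"
        using inverse_mult_eq_1'[of "qfac fps_X j :: 'a fps"] qfac_nth_0[of 1 j, where ?'a = 'a] by simp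
      also have "eqm L 1 (qfac fps_X j * (qbin fps_X n (int j) :: 'a fps))"
        using qbin_eqm[of 1, OF _ X1, of L n "int j"] n True by (auto intro: eqm_sym)
      finally show ?thesis
        using qfac_nth_0[of 1 j, where ?'a = 'a] by (intro eqm_mult eqm_refl) (auto dest: eqm_cancel)
    next
      case False
      then show ?thesis by (intro eqm_X_power_mult) (simp add: trans_less_add2)
    qed
  qed
  have "eqm L (qfac fps_X L * S) (qfac fps_X L * (\<Sum>j\<in>theta_range n. sg j * fps_X ^ theta_exp j * qbin fps_X (2 * n + 1) (int n + 1 + 2 * j)))"
    using 1 unfolding finite_RR_fps by (intro eqm_mult eqm_refl)
  also have "eqm L \<dots> T"
    unfolding T_def by (rule theta_eqm, rule qbin_eqm'[of 1]) (use n in auto)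
  finally have 2: "eqm L (qfac fps_X L * S) T" .
  have "eqm L (qfac (fps_X ^ 5) n * P) (qfac (fps_X ^ 5) L * P)"
    by (intro eqm_mult eqm_refl qfac_eqm) (use n in auto)
  also have "eqm L \<dots> T"
    unfolding T_def P_def finite_JTP_fps[symmetric]
    by (rule theta_eqm, rule qbin_eqm'[of 5]) (use n in auto)
  finally have 3: "eqm L (qfac (fps_X ^ 5) n * P) T" .
  have 4: "qfac fps_X (5 * n) = qfac (fps_X ^ 5) n * P * V"
  proof -
    have e: "Suc (5 * i) = 5 * i + 1" "Suc (5 * i + 1) = 5 * i + 2" "Suc (5 * i + 2) = 5 * i + 3"
      "Suc (5 * i + 3) = 5 * i + 4" "Suc (5 * i + 4) = 5 * Suc i" for i
      by simp_all
    show ?thesis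
      unfolding qfac_def prod_blocks5 P_def V_def prod.distrib[symmetric] e power_mult[symmetric]
      by (simp only: mult_ac)
  qed
  have "eqm L (qfac fps_X (5 * n) * S) (qfac fps_X L * S)"
    using qfac_eqm[of 1 L "5 * n", where ?'a = 'a] n by (intro eqm_mult eqm_refl) auto
  also note 2
  also note eqm_sym[OF 3]
  finally have "eqm L ((qfac (fps_X ^ 5) n * P) * (V * S)) ((qfac (fps_X ^ 5) n * P) * 1)"
    unfolding 4 by (simp add: mult.assoc)
  then have "eqm L (V * S) 1"
  proof (rule eqm_cancel)
    \<comment> \<open>The constant coefficient of the whole product is 1, so that of the factor to
      be cancelled is nonzero.\<close>
    have "fps_nth (qfac (fps_X ^ 5) n * P * V) 0 = 1"
      unfolding 4[symmetric] using qfac_nth_0[of 1 "5 * n", where ?'a = 'a] by simp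
    then have "fps_nth (qfac (fps_X ^ 5) n * P) 0 * fps_nth V 0 = 1"
      by (simp only: fps_mult_nth_0)
    then show "fps_nth (qfac (fps_X ^ 5) n * P) 0 \<noteq> 0"
      by (metis mult_zero_left zero_neq_one)
  qed
  then show ?thesis by (simp add: V_def S_def)
qed

section \<open>Multiplicity functions of partitions\<close>

text \<open>Forcing the value 0 outside \<open>S\<close> makes each function determined by its
  values on \<open>S\<close>, so that counting functions counts partitions.\<close>

definition mults :: "nat set \<Rightarrow> (nat \<Rightarrow> nat set) \<Rightarrow> nat \<Rightarrow> (nat \<Rightarrow> nat) set" where
  "mults S A N = {c. (\<forall>s. s \<notin> S \<longrightarrow> c s = 0) \<and> (\<forall>s\<in>S. c s \<in> A s) \<and> (\<Sum>s\<in>S. s * c s) = N}"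

text \<open>For s > 0 this is the sum of X^(s i) over i in \<open>A\<close>.\<close>

definition part_gf :: "nat \<Rightarrow> nat set \<Rightarrow> 'a::comm_ring_1 fps" where
  "part_gf s A = Abs_fps (\<lambda>n. if s dvd n \<and> n div s \<in> A then 1 else 0)"

text \<open>Classify by the amount i = t * c(t) that the part size \<open>t\<close>
  contributes.\<close>

lemma mults_insert:
  assumes "finite S" "t \<notin> S" "t > 0"
  shows "mults (insert t S) A N
    = (\<Union>i\<in>{i\<in>{0..N}. t dvd i \<and> i div t \<in> A t}. (\<lambda>c. c(t := i div t)) ` mults S A (N - i))"
proof (intro set_eqI iffI)
  fix c assume c: "c \<in> mults (insert t S) A N"
  let ?i = "t * c t"
  have s: "(\<Sum>s\<in>S. s * (c(t := 0)) s) = (\<Sum>s\<in>S. s * c s)"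
    using assms by (intro sum.cong) auto
  have "c(t := 0) \<in> mults S A (N - ?i)"
    using c assms s by (auto simp: mults_def)
  moreover have "c = (c(t := 0))(t := ?i div t)" using assms by auto
  moreover have "?i \<in> {i\<in>{0..N}. t dvd i \<and> i div t \<in> A t}"
    using c assms by (auto simp: mults_def)
  ultimately show "c \<in> (\<Union>i\<in>{i\<in>{0..N}. t dvd i \<and> i div t \<in> A t}. (\<lambda>c. c(t := i div t)) ` mults S A (N - i))"
    by blast
next
  fix c assume "c \<in> (\<Union>i\<in>{i\<in>{0..N}. t dvd i \<and> i div t \<in> A t}. (\<lambda>c. c(t := i div t)) ` mults S A (N - i))"
  then obtain i b where i: "i \<le> N" "t dvd i" "i div t \<in> A t" "b \<in> mults S A (N - i)" "c = b(t := i div t)"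
    by auto
  have s: "(\<Sum>s\<in>S. s * c s) = (\<Sum>s\<in>S. s * b s)"
    using assms i by (intro sum.cong) auto
  show "c \<in> mults (insert t S) A N"
    using i assms s by (auto simp: mults_def)
qed

text \<open>Inserting a part size splits the set into disjoint classes whose cardinalities form a
  Cauchy product.\<close>

lemma card_mults:
  assumes "finite S" "0 \<notin> S"
  shows "finite (mults S A N) \<and> of_nat (card (mults S A N)) = fps_nth (\<Prod>s\<in>S. part_gf s (A s) :: 'a::comm_ring_1 fps) N"
  using assms
proof (induction S arbitrary: N rule: finite_induct)
  case empty
  have "mults {} A N = (if N = 0 then {\<lambda>_. 0} else {})" by (auto simp: mults_def)
  then show ?case by simp
next
  case (insert t S)
  let ?I = "{i\<in>{0..N}. t dvd i \<and> i div t \<in> A t}"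
  have IH: "finite (mults S A M)" "of_nat (card (mults S A M)) = fps_nth (\<Prod>s\<in>S. part_gf s (A s) :: 'a fps) M" for M
    using insert by auto
  have t: "t > 0" using insert.prems by auto
  note eq = mults_insert[OF insert.hyps t, of A N]
  have inj: "inj_on (\<lambda>c. c(t := k)) (mults S A M)" for k M
  proof (rule inj_onI)
    fix b c assume "b \<in> mults S A M" "c \<in> mults S A M" "b(t := k) = c(t := k)"
    then show "b = c"
      using insert.hyps(2) by (auto simp: mults_def fun_eq_iff split: if_splits) metis
  qed
  have "card (mults (insert t S) A N) = (\<Sum>i\<in>?I. card ((\<lambda>c. c(t := i div t)) ` mults S A (N - i)))"
    unfolding eq
  proof (rule card_UN_disjoint)
    show "\<forall>i\<in>?I. \<forall>j\<in>?I. i \<noteq> j \<longrightarrow> (\<lambda>c. c(t := i div t)) ` mults S A (N - i) \<inter> (\<lambda>c. c(t := j div t)) ` mults S A (N - j) = {}"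
    proof (intro ballI impI)
      fix i j assume "i \<in> ?I" "j \<in> ?I" "i \<noteq> j"
      then have "i div t \<noteq> j div t" by (metis (mono_tags, lifting) dvd_div_mult_self mem_Collect_eq)
      then show "(\<lambda>c. c(t := i div t)) ` mults S A (N - i) \<inter> (\<lambda>c. c(t := j div t)) ` mults S A (N - j) = {}"
        by (auto dest: fun_cong[of _ _ t])
    qed
  qed (use IH in auto)
  also have "\<dots> = (\<Sum>i\<in>?I. card (mults S A (N - i)))"
    by (intro sum.cong refl card_image inj)
  finally have "of_nat (card (mults (insert t S) A N)) = (\<Sum>i\<in>?I. fps_nth (\<Prod>s\<in>S. part_gf s (A s) :: 'a fps) (N - i))"
    by (simp add: IH)
  also have "\<dots> = (\<Sum>i\<in>{0..N}. fps_nth (part_gf t (A t)) i * fps_nth (\<Prod>s\<in>S. part_gf s (A s) :: 'a fps) (N - i))"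
    by (rule sum.mono_neutral_cong_left) (auto simp: part_gf_def)
  also have "\<dots> = fps_nth (\<Prod>s\<in>insert t S. part_gf s (A s)) N"
    using insert.hyps by (simp add: fps_mult_nth)
  finally show ?case using IH eq by auto
qed

lemma part_gf_UNIV:
  assumes "s > 0"
  shows "part_gf s UNIV * (1 - fps_X ^ s) = (1 :: 'a::comm_ring_1 fps)"
proof (rule fps_ext)
  fix n
  have "fps_nth (part_gf s UNIV * (1 - fps_X ^ s)) n
    = fps_nth (part_gf s UNIV :: 'a fps) n - (if n < s then 0 else fps_nth (part_gf s UNIV) (n - s))"
    by (simp add: right_diff_distrib fps_X_power_mult_right_nth)
  also have "\<dots> = fps_nth 1 n"
    using assms by (auto simp: part_gf_def dvd_minus_self dest: dvd_imp_le)
  finally show "fps_nth (part_gf s UNIV * (1 - fps_X ^ s)) n = fps_nth (1 :: 'a fps) n" .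
qed

lemma part_gf_singleton:
  assumes "s > 0"
  shows "part_gf s {k} = (fps_X ^ (s * k) :: 'a::comm_ring_1 fps)"
  using assms by (intro fps_ext) (auto simp: part_gf_def fps_X_power_nth)

text \<open>The telescoping of X^a + ... + X^(a+M).\<close>

lemma part_gf_interval:
  "part_gf 1 {a..a + M} * (1 - fps_X) = (fps_X ^ a * (1 - fps_X ^ (M + 1)) :: 'a::comm_ring_1 fps)"
proof (rule fps_ext)
  fix n
  have "fps_nth (part_gf 1 {a..a + M} * (1 - fps_X ^ 1)) n
    = fps_nth (part_gf 1 {a..a + M} :: 'a fps) n - (if n < 1 then 0 else fps_nth (part_gf 1 {a..a + M}) (n - 1))"
    unfolding right_diff_distrib fps_sub_nth fps_X_power_mult_right_nth by simp
  also have "\<dots> = fps_nth (fps_X ^ a * (1 - fps_X ^ (M + 1))) n"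
    by (auto simp: part_gf_def fps_X_power_mult_nth right_diff_distrib fps_X_power_nth simp flip: power_add)
  finally show "fps_nth (part_gf 1 {a..a + M} * (1 - fps_X)) n = fps_nth (fps_X ^ a * (1 - fps_X ^ (M + 1)) :: 'a fps) n"
    by simp
qed

lemma partition_eqI:
  assumes "sorted_wrt (\<ge>) xs" "sorted_wrt (\<ge>) (ys :: nat list)" "\<And>s. count_list xs s = count_list ys s"
  shows "xs = ys"
proof -
  have "mset (rev xs) = mset (rev ys)"
    using assms(3) by (intro multiset_eqI) (simp add: count_mset)
  moreover have "sorted (rev xs)" "sorted (rev ys)"
    using assms by (simp_all add: sorted_wrt_rev)
  ultimately have "rev xs = rev ys"
    by (metis properties_for_sort)
  then show ?thesis by simp
qed

text \<open>A weakly decreasing list is determined by its multiset, and conversely sorting the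
  multiset with given multiplicities yields such a list.\<close>

lemma bij_betw_partitions_mults:
  assumes "finite S" "0 \<notin> S"
  shows "bij_betw count_list {xs. partition_of N xs \<and> set xs \<subseteq> S \<and> (\<forall>s\<in>S. count_list xs s \<in> A s)} (mults S A N)"
  unfolding bij_betw_def
proof (intro conjI set_eqI iffI)
  show "inj_on count_list {xs. partition_of N xs \<and> set xs \<subseteq> S \<and> (\<forall>s\<in>S. count_list xs s \<in> A s)}"
    by (intro inj_onI partition_eqI) (auto simp: partition_of_def)
next
  fix c assume "c \<in> count_list ` {xs. partition_of N xs \<and> set xs \<subseteq> S \<and> (\<forall>s\<in>S. count_list xs s \<in> A s)}"
  then obtain xs where xs: "partition_of N xs" "set xs \<subseteq> S" "\<forall>s\<in>S. count_list xs s \<in> A s" and c: "c = count_list xs"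
    by auto
  have "N = sum_list (map (\<lambda>x. x) xs)" using xs by (simp add: partition_of_def)
  also have "\<dots> = (\<Sum>x\<in>set xs. count_list xs x * x)" by (rule sum_list_map_eq_sum_count)
  also have "\<dots> = (\<Sum>s\<in>S. s * c s)"
    using assms xs(2) by (intro sum.mono_neutral_cong_left) (auto simp: c)
  finally show "c \<in> mults S A N" using xs by (auto simp: mults_def c count_list_0_iff)
next
  fix c assume c: "c \<in> mults S A N"
  have "finite {s. c s > 0}"
    by (rule finite_subset[OF _ assms(1)]) (use c in \<open>auto simp: mults_def\<close>)
  then have cnt: "count (Abs_multiset c) = c" by (simp add: Abs_multiset_inverse)
  define xs where "xs = rev (sorted_list_of_multiset (Abs_multiset c))"
  have cl: "count_list xs = c"
    by (rule ext) (simp add: xs_def count_mset[symmetric] cnt)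
  have sub: "set xs \<subseteq> S"
    using c cl by (auto simp: mults_def) (metis count_list_0_iff)
  have "sum_list (map (\<lambda>x. x) xs) = (\<Sum>x\<in>set xs. count_list xs x * x)" by (rule sum_list_map_eq_sum_count)
  also have "\<dots> = (\<Sum>s\<in>S. s * c s)"
    using assms sub by (intro sum.mono_neutral_cong_left) (auto simp flip: cl)
  also have "\<dots> = N" using c by (simp add: mults_def)
  finally have "sum_list xs = N" by simp
  moreover have "sorted_wrt (\<ge>) xs"
    by (simp add: xs_def sorted_wrt_rev)
  moreover have "\<forall>x\<in>set xs. 0 < x" using sub assms(2) by (metis gr0I subsetD)
  moreover have "\<forall>s\<in>S. count_list xs s \<in> A s" using c by (simp add: cl mults_def)
  ultimately show "c \<in> count_list ` {xs. partition_of N xs \<and> set xs \<subseteq> S \<and> (\<forall>s\<in>S. count_list xs s \<in> A s)}"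
    using sub cl by (auto simp: partition_of_def)
qed

section \<open>Removing the staircase\<close>

text \<open>The inverse of passing to \<open>col_star\<close>: \<open>c s\<close> is the number of
  columns of length s placed beside the staircase, and the row at position i (from 0) meets exactly
  the columns of length greater than i.\<close>

definition stair :: "nat \<Rightarrow> (nat \<Rightarrow> nat) \<Rightarrow> nat list" where
  "stair m c = map (\<lambda>i. 2 * (m - i) + (\<Sum>s\<in>{i<..m}. c s)) [0..<m]"

lemma length_stair [simp]: "length (stair m c) = m"
  by (simp add: stair_def)

lemma nth_stair [simp]: "i < m \<Longrightarrow> stair m c ! i = 2 * (m - i) + (\<Sum>s\<in>{i<..m}. c s)"
  by (simp add: stair_def)

lemma sum_tail_mono: "(i::nat) \<le> j \<Longrightarrow> (\<Sum>s\<in>{j<..m}. c s) \<le> (\<Sum>s\<in>{i<..m}. c s :: nat)"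
  by (rule sum_mono2) auto

lemma sum_tail_step: "i < m \<Longrightarrow> (\<Sum>s\<in>{i<..m}. c s) = c (Suc i) + (\<Sum>s\<in>{Suc i<..m}. c s :: nat)"
proof -
  assume "i < m"
  then have "{i<..m} = insert (Suc i) {Suc i<..m}" by auto
  then show ?thesis by simp
qed

text \<open>The staircase 2 + 4 + ... + 2m contributes m(m+1); the other cells are counted by
  columns instead of rows.\<close>

lemma sum_list_stair: "sum_list (stair m c) = m * (m + 1) + (\<Sum>s\<in>{1..m}. s * c s)"
proof -
  have 1: "(\<Sum>i<m. 2 * (m - i)) = m * (m + 1)"
  proof (induction m)
    case (Suc m)
    have "(\<Sum>i<Suc m. 2 * (Suc m - i)) = (\<Sum>i<Suc m. 2 * (m - i) + 2)"
      by (intro sum.cong) auto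
    also have "\<dots> = (\<Sum>i<m. 2 * (m - i)) + 2 * (m + 1)"
      unfolding sum.distrib by simp
    finally show ?case unfolding Suc by simp
  qed simp
  have 2: "(\<Sum>i<m. \<Sum>s\<in>{i<..m}. c s) = (\<Sum>s\<in>{1..m}. s * c s)"
  proof (induction m)
    case (Suc m)
    have "(\<Sum>i<Suc m. \<Sum>s\<in>{i<..Suc m}. c s) = (\<Sum>i<Suc m. (\<Sum>s\<in>{i<..m}. c s) + c (Suc m))"
    proof (intro sum.cong)
      fix i assume "i \<in> {..<Suc m}"
      then have "{i<..Suc m} = insert (Suc m) {i<..m}" by auto
      then show "(\<Sum>s\<in>{i<..Suc m}. c s) = (\<Sum>s\<in>{i<..m}. c s) + c (Suc m)" by simp
    qed simp
    then show ?case by (simp add: sum.distrib Suc)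
  qed simp
  show ?thesis
    unfolding stair_def sum_list_distinct_conv_sum_set[OF distinct_upt]
    by (simp add: sum.distrib 1 2 atLeast0LessThan)
qed

section \<open>Multiplicities of column lengths\<close>

lemma conjugate_filter_antimono:
  fixes d :: "nat \<Rightarrow> nat"
  assumes "\<And>i j. i \<le> j \<Longrightarrow> d j \<le> d i" "m > 0"
  shows "conjugate (filter (\<lambda>x. x \<noteq> 0) (map d [0..<m])) = map (\<lambda>j. card {i. i < m \<and> j \<le> d i}) [1..<Suc (d 0)]"
proof -
  let ?ys = "filter (\<lambda>x. x \<noteq> 0) (map d [0..<m])"
  have hd: "(case ?ys of [] \<Rightarrow> 0 | x # _ \<Rightarrow> x) = d 0"
  proof (cases "d 0 = 0")
    case True
    then have "d i = 0" for i using assms(1)[of 0 i] by simp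
    then show ?thesis by simp
  next
    case False
    then show ?thesis using assms(2) by (simp add: upt_conv_Cons)
  qed
  have "length (filter (\<lambda>x. j \<le> x) ?ys) = card {i. i < m \<and> j \<le> d i}" if "j \<ge> 1" for j
  proof -
    have "filter (\<lambda>x. j \<le> x) ?ys = filter (\<lambda>x. j \<le> x) (map d [0..<m])"
      using that by (auto intro: filter_cong)
    then have "length (filter (\<lambda>x. j \<le> x) ?ys) = length (filter (\<lambda>i. j \<le> d i) [0..<m])"
      by (simp add: filter_map comp_def)
    also have "\<dots> = card ({i. j \<le> d i} \<inter> set [0..<m])"
      by (rule distinct_length_filter) simp
    also have "{i. j \<le> d i} \<inter> set [0..<m] = {i. i < m \<and> j \<le> d i}" by auto
    finally show ?thesis .
  qed
  then show ?thesis
    unfolding conjugate_def hd by (intro map_cong refl) auto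
qed

text \<open>The j-th column has length s exactly when d(s) < j <= d(s-1).\<close>

lemma count_conjugate:
  fixes d :: "nat \<Rightarrow> nat"
  assumes anti: "\<And>i j. i \<le> j \<Longrightarrow> d j \<le> d i" and "d m = 0" and s: "1 \<le> s" "s \<le> m"
  shows "count_list (conjugate (filter (\<lambda>x. x \<noteq> 0) (map d [0..<m]))) s = d (s - 1) - d s"
proof -
  have iff: "s = card {i. i < m \<and> j \<le> d i} \<longleftrightarrow> d s < j \<and> j \<le> d (s - 1)" if j: "j \<ge> 1" for j
  proof
    assume c: "s = card {i. i < m \<and> j \<le> d i}"
    have "d s < j"
    proof (rule ccontr)
      assume "\<not> d s < j"
      then have "j \<le> d s" by simp
      \<comment> \<open>At s = m the inequality 1 <= j <= d(s) would contradict d(m) = 0.\<close>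
      moreover from this have "s < m" using j assms(2) s by (cases "s = m") auto
      ultimately have "{..s} \<subseteq> {i. i < m \<and> j \<le> d i}"
        using anti by (auto intro: order_trans)
      then have "card {..s} \<le> s" unfolding c[symmetric] by (subst (2) c) (rule card_mono, auto)
      then show False by simp
    qed
    moreover have "j \<le> d (s - 1)"
    proof (rule ccontr)
      assume n: "\<not> j \<le> d (s - 1)"
      have "{i. i < m \<and> j \<le> d i} \<subseteq> {..<s - 1}"
      proof
        fix i assume "i \<in> {i. i < m \<and> j \<le> d i}"
        then show "i \<in> {..<s - 1}" using n anti[of "s - 1" i] by (cases "s - 1 \<le> i") auto
      qed
      then have "s \<le> card {..<s - 1}" by (subst c) (rule card_mono, auto)
      then show False using s by simp
    qed
    ultimately show "d s < j \<and> j \<le> d (s - 1)" ..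
  next
    assume a: "d s < j \<and> j \<le> d (s - 1)"
    have "{i. i < m \<and> j \<le> d i} = {..<s}"
    proof (intro set_eqI iffI)
      fix i assume "i \<in> {i. i < m \<and> j \<le> d i}"
      then show "i \<in> {..<s}" using a anti[of s i] by (cases "s \<le> i") auto
    next
      fix i assume "i \<in> {..<s}"
      then have "i < m" "i \<le> s - 1" using s by auto
      then show "i \<in> {i. i < m \<and> j \<le> d i}" using a anti[of i "s - 1"] by auto
    qed
    then show "s = card {i. i < m \<and> j \<le> d i}" by simp
  qed
  have "count_list (conjugate (filter (\<lambda>x. x \<noteq> 0) (map d [0..<m]))) s
    = length (filter (\<lambda>j. s = card {i. i < m \<and> j \<le> d i}) [1..<Suc (d 0)])"
    using s by (subst conjugate_filter_antimono[OF anti]) (auto simp: count_list_eq_length_filter filter_map comp_def)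
  also have "\<dots> = card ({j. s = card {i. i < m \<and> j \<le> d i}} \<inter> set [1..<Suc (d 0)])"
    by (rule distinct_length_filter) simp
  also have "{j. s = card {i. i < m \<and> j \<le> d i}} \<inter> set [1..<Suc (d 0)] = {d s<..d (s - 1)}"
  proof (intro set_eqI iffI)
    fix j assume "j \<in> {j. s = card {i. i < m \<and> j \<le> d i}} \<inter> set [1..<Suc (d 0)]"
    then have "1 \<le> j" "s = card {i. i < m \<and> j \<le> d i}" by auto
    then show "j \<in> {d s<..d (s - 1)}" using iff[of j] by (metis greaterThanAtMost_iff)
  next
    fix j assume j: "j \<in> {d s<..d (s - 1)}"
    then have j1: "1 \<le> j" "j \<le> d 0" using anti[of 0 "s - 1"] by auto
    then have "j \<in> set [1..<Suc (d 0)]" by (simp only: set_upt atLeastLessThan_iff less_Suc_eq_le)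
    moreover have "s = card {i. i < m \<and> j \<le> d i}"
      unfolding iff[OF j1(1)] using j by simp
    ultimately show "j \<in> {j. s = card {i. i < m \<and> j \<le> d i}} \<inter> set [1..<Suc (d 0)]"
      by (intro IntI CollectI)
  qed
  finally show ?thesis by simp
qed

lemma count_col_star_stair:
  assumes "1 \<le> s" "s \<le> m"
  shows "count_list (col_star (stair m c)) s = c s"
proof -
  let ?d = "\<lambda>i. \<Sum>s\<in>{i<..m}. c s"
  have "map (\<lambda>i. stair m c ! i - 2 * (length (stair m c) - i)) [0..<length (stair m c)] = map ?d [0..<m]"
    by (intro map_cong) auto
  then have "col_star (stair m c) = conjugate (filter (\<lambda>x. x \<noteq> 0) (map ?d [0..<m]))"
    unfolding col_star_def by (simp only:)
  also have "count_list \<dots> s = ?d (s - 1) - ?d s"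
    by (rule count_conjugate) (use assms sum_tail_mono in auto)
  also have "\<dots> = c s" using sum_tail_step[of "s - 1" m c] assms by simp
  finally show ?thesis .
qed

lemma stair_partition: "partition_of (m * (m + 1) + (\<Sum>s\<in>{1..m}. s * c s)) (stair m c)"
proof -
  have "sorted_wrt (\<ge>) (stair m c)"
    unfolding sorted_wrt_iff_nth_less
    by (auto intro!: add_mono sum_tail_mono)
  moreover have "\<forall>x\<in>set (stair m c). 0 < x" by (auto simp: stair_def)
  ultimately show ?thesis unfolding partition_of_def by (simp add: sum_list_stair)
qed

lemma stair_Diff2_star: "stair m c \<in> Diff2_star"
proof -
  have "int (stair m c ! i) - int (stair m c ! Suc i) \<ge> 2" if "Suc i < m" for i
  proof -
    have "m - i = Suc (m - Suc i)" using that by simp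
    then have "stair m c ! Suc i + 2 \<le> stair m c ! i"
      using that sum_tail_mono[of i "Suc i" c m] by simp
    then show ?thesis by linarith
  qed
  moreover have "1 \<notin> set (stair m c)" by (auto simp: stair_def)
  ultimately show ?thesis
    using stair_partition[of m c] by (auto simp: Diff2_star_def Diff2_def is_partition_def partition_of_def)
qed

text \<open>The gaps of the partition beyond the required 2 can be read off as column
  multiplicities; downward induction on the position rebuilds the parts from them.\<close>

lemma Diff2_star_stair:
  assumes "xs \<in> Diff2_star"
  obtains c where "xs = stair (length xs) c" "\<And>s. s \<notin> {1..length xs} \<Longrightarrow> c s = 0"
proof
  let ?m = "length xs"
  \<comment> \<open>The excess over 2 of the difference between the s-th part and the next one, a
    part 0 being imagined after the last.\<close>
  define c where "c s = (if s \<in> {1..?m} then xs ! (s - 1) - (if s < ?m then xs ! s + 2 else 2) else 0)" for s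
  show "c s = 0" if "s \<notin> {1..?m}" for s using that by (auto simp: c_def)
  have "xs ! i = 2 * (?m - i) + (\<Sum>s\<in>{i<..?m}. c s)" if "i < ?m" for i
  proof -
    have "i \<le> ?m - 1" using that by simp
    then show ?thesis
    proof (induction i rule: inc_induct)
      case base
      have m: "Suc 0 \<le> ?m" using that by linarith
      then have "{?m - 1<..?m} = {?m}" by auto
      moreover have "2 \<le> xs ! (?m - 1)" using Diff2_star_nth_ge[OF assms, of "?m - 1"] m by simp
      ultimately show ?case using m by (simp add: c_def)
    next
      case (step n)
      have n: "Suc n < ?m" using step.hyps by linarith
      then have "int (xs ! n) - int (xs ! Suc n) \<ge> 2"
        using assms by (auto simp: Diff2_star_def Diff2_def)
      then have "xs ! Suc n + 2 \<le> xs ! n" by linarith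
      then have "c (Suc n) + xs ! Suc n + 2 = xs ! n"
        using n by (simp add: c_def)
      moreover have "?m - n = Suc (?m - Suc n)" using step.hyps by simp
      ultimately show ?case
        using step.IH step.hyps sum_tail_step[of n ?m c] by simp
    qed
  qed
  then show "xs = stair ?m c" by (intro nth_equalityI) auto
qed

lemma bij_betw_stair:
  "bij_betw (stair m) (mults {1..m} A N)
     {xs \<in> Diff2_star. partition_of (m * (m + 1) + N) xs \<and> length xs = m \<and> (\<forall>s\<in>{1..m}. count_list (col_star xs) s \<in> A s)}"
  unfolding bij_betw_def
proof (intro conjI set_eqI iffI)
  show "inj_on (stair m) (mults {1..m} A N)"
  proof (intro inj_onI ext)
    fix b c s assume "b \<in> mults {1..m} A N" "c \<in> mults {1..m} A N" "stair m b = stair m c"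
    then show "b s = c s"
      using count_col_star_stair[of s m b] count_col_star_stair[of s m c]
      by (cases "s \<in> {1..m}") (auto simp: mults_def)
  qed
next
  fix xs assume "xs \<in> stair m ` mults {1..m} A N"
  then obtain c where c: "c \<in> mults {1..m} A N" "xs = stair m c" by auto
  then show "xs \<in> {xs \<in> Diff2_star. partition_of (m * (m + 1) + N) xs \<and> length xs = m \<and> (\<forall>s\<in>{1..m}. count_list (col_star xs) s \<in> A s)}"
    using stair_partition[of m c] by (simp add: stair_Diff2_star count_col_star_stair mults_def)
next
  fix xs assume "xs \<in> {xs \<in> Diff2_star. partition_of (m * (m + 1) + N) xs \<and> length xs = m \<and> (\<forall>s\<in>{1..m}. count_list (col_star xs) s \<in> A s)}"
  then have xs: "xs \<in> Diff2_star" "partition_of (m * (m + 1) + N) xs" "length xs = m" "\<forall>s\<in>{1..m}. count_list (col_star xs) s \<in> A s"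
    by auto
  obtain c where c: "xs = stair m c" "\<And>s. s \<notin> {1..m} \<Longrightarrow> c s = 0"
    using Diff2_star_stair[OF xs(1)] xs(3) by metis
  have "sum_list xs = m * (m + 1) + N" using xs(2) by (simp add: partition_of_def)
  then have "(\<Sum>s\<in>{1..m}. s * c s) = N" unfolding c(1) sum_list_stair by simp
  then have "c \<in> mults {1..m} A N"
    using c xs(4) by (auto simp: mults_def count_col_star_stair)
  then show "xs \<in> stair m ` mults {1..m} A N" using c(1) by blast
qed

section \<open>Generating functions of both sides\<close>

lemma inverse_eqI: "a * b = 1 \<Longrightarrow> b = inverse (a :: 'a::field fps)"
  by (metis fps_inverse_unique)

lemma part_gf_UNIV_inverse: "s > 0 \<Longrightarrow> part_gf s UNIV = inverse (1 - fps_X ^ s :: 'a::field fps)"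
  using part_gf_UNIV[of s, where ?'a = 'a] by (intro inverse_eqI) (simp add: mult.commute)

lemma prod_inverse_fps:
  "(\<Prod>s\<in>S. inverse (f s)) = inverse (\<Prod>s\<in>S. f s :: 'a::field fps)"
  by (induction S rule: infinite_finite_induct) (auto simp: fps_inverse_mult)

text \<open>Compared with the unrestricted product only the factor at \<open>t\<close> changes, from
  1/(1-X^t) to X^(t k).\<close>

lemma prod_part_gf_singleton:
  assumes "finite S" "t \<in> S" "0 \<notin> S"
  shows "(\<Prod>s\<in>S. part_gf s (if s = t then {k} else UNIV))
    = (fps_X ^ (t * k) * (1 - fps_X ^ t) * inverse (\<Prod>s\<in>S. 1 - fps_X ^ s) :: 'a::field fps)"
proof -
  have t: "t > 0" using assms by (metis gr0I)
  let ?Q = "\<Prod>s\<in>S - {t}. inverse (1 - fps_X ^ s) :: 'a fps"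
  have "(\<Prod>s\<in>S. part_gf s (if s = t then {k} else UNIV))
    = part_gf t {k} * (\<Prod>s\<in>S - {t}. part_gf s (if s = t then {k} else UNIV) :: 'a fps)"
    using assms by (simp add: prod.remove)
  also have "(\<Prod>s\<in>S - {t}. part_gf s (if s = t then {k} else UNIV) :: 'a fps) = ?Q"
    by (intro prod.cong refl) (use assms in \<open>auto intro!: part_gf_UNIV_inverse gr0I\<close>)
  also have "?Q = (1 - fps_X ^ t) * (inverse (1 - fps_X ^ t) * ?Q)"
    using inverse_mult_eq_1'[of "1 - fps_X ^ t :: 'a fps"] t by (simp flip: mult.assoc)
  also have "inverse (1 - fps_X ^ t) * ?Q = (\<Prod>s\<in>S. inverse (1 - fps_X ^ s))"
    using assms by (simp add: prod.remove)
  finally show ?thesis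
    using part_gf_singleton[OF t, where ?'a = 'a] by (simp only: prod_inverse_fps mult.assoc)
qed

text \<open>Only the factor at 1 changes. For a = (M+1)k the result has the same prefactor as fixing
  the multiplicity of M+1 to be k, which is why conditions (2) and (3) fit together.\<close>

lemma prod_part_gf_interval:
  assumes "finite S" "1 \<in> S" "0 \<notin> S"
  shows "(\<Prod>s\<in>S. part_gf s (if s = 1 then {a..a + M} else UNIV))
    = (fps_X ^ a * (1 - fps_X ^ (M + 1)) * inverse (\<Prod>s\<in>S. 1 - fps_X ^ s) :: 'a::field fps)"
proof -
  let ?Q = "\<Prod>s\<in>S - {1}. inverse (1 - fps_X ^ s) :: 'a fps"
  have "(\<Prod>s\<in>S. part_gf s (if s = 1 then {a..a + M} else UNIV))
    = part_gf 1 {a..a + M} * (\<Prod>s\<in>S - {1}. part_gf s (if s = 1 then {a..a + M} else UNIV) :: 'a fps)"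
    using assms(1,2) prod.remove[OF assms(1,2), of "\<lambda>s. part_gf s (if s = 1 then {a..a + M} else UNIV) :: 'a fps"] by simp
  also have "(\<Prod>s\<in>S - {1}. part_gf s (if s = 1 then {a..a + M} else UNIV) :: 'a fps) = ?Q"
    by (intro prod.cong refl) (use assms in \<open>auto intro!: part_gf_UNIV_inverse gr0I\<close>)
  also have "?Q = (1 - fps_X) * (inverse (1 - fps_X) * ?Q)"
    using inverse_mult_eq_1'[of "1 - fps_X :: 'a fps"] by (simp flip: mult.assoc)
  also have "inverse (1 - fps_X) * ?Q = (\<Prod>s\<in>S. inverse (1 - fps_X ^ s))"
    using prod.remove[OF assms(1,2), of "\<lambda>s. inverse (1 - fps_X ^ s) :: 'a fps"] by simp
  finally show ?thesis
    using part_gf_interval[of a M, where ?'a = 'a] by (simp only: prod_inverse_fps mult.assoc[symmetric])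
qed

lemma qfac_X_alt: "qfac fps_X m = (\<Prod>s\<in>{1..m}. 1 - fps_X ^ s :: 'a::comm_ring_1 fps)"
  unfolding qfac_def by (rule prod.reindex_bij_witness[of _ "\<lambda>s. s - 1" Suc]) auto

lemma card_stair_class:
  fixes m N :: nat
  shows "of_nat (card {xs \<in> Diff2_star. partition_of N xs \<and> length xs = m \<and> (\<forall>s\<in>{1..m}. count_list (col_star xs) s \<in> A s)})
    = fps_nth (fps_X ^ (m * m + m) * (\<Prod>s\<in>{1..m}. part_gf s (A s)) :: 'a::comm_ring_1 fps) N" (is "of_nat (card (?R N)) = _")
proof (cases "m * m + m \<le> N")
  case True
  define N' where "N' = N - (m * m + m)"
  have N: "N = m * (m + 1) + N'" using True by (simp add: N'_def)
  have "card (mults {1..m} A N') = card (?R (m * (m + 1) + N'))"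
    by (rule bij_betw_same_card[OF bij_betw_stair])
  moreover have "of_nat (card (mults {1..m} A N')) = fps_nth (\<Prod>s\<in>{1..m}. part_gf s (A s) :: 'a fps) N'"
    using card_mults[of "{1..m}" A N', where ?'a = 'a] by simp
  ultimately show ?thesis using True by (simp add: N[symmetric] fps_X_power_mult_nth N'_def)
next
  case False
  \<comment> \<open>The staircase alone already has size m^2+m > N.\<close>
  have "?R N = {}"
  proof safe
    fix xs assume xs: "xs \<in> Diff2_star" "partition_of N xs" "m = length xs"
    obtain c where "xs = stair m c" using Diff2_star_stair[OF xs(1)] xs(3) by metis
    then have "N = m * (m + 1) + (\<Sum>s\<in>{1..m}. s * c s)"
      using xs(2) sum_list_stair[of m c] by (simp add: partition_of_def)
    then show "xs \<in> {}" using False by simp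
  qed
  then show ?thesis using False by (simp add: fps_X_power_mult_nth del: Collect_empty_eq)
qed

section \<open>Parts congruent to 2 or 3 modulo 5, truncated to a finite set\<close>

definition rr_parts :: "nat \<Rightarrow> nat set" where
  "rr_parts n = (\<lambda>i. 5 * i + 2) ` {..<n} \<union> (\<lambda>i. 5 * i + 3) ` {..<n}"

lemma rr_parts_iff: "s \<in> rr_parts n \<longleftrightarrow> s < 5 * n \<and> (s mod 5 = 2 \<or> s mod 5 = 3)"
proof
  assume "s \<in> rr_parts n"
  then obtain i where "i < n" "s = 5 * i + 2 \<or> s = 5 * i + 3" by (auto simp: rr_parts_def)
  moreover have "(5 * i + 2) mod 5 = 2" "(5 * i + 3) mod 5 = 3"
    using mod_mult_self3[of i 5 2] mod_mult_self3[of i 5 3] by (simp_all add: mult.commute)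
  ultimately show "s < 5 * n \<and> (s mod 5 = 2 \<or> s mod 5 = 3)" by (elim disjE) simp_all
next
  assume s: "s < 5 * n \<and> (s mod 5 = 2 \<or> s mod 5 = 3)"
  then have "s div 5 < n" by auto
  moreover have "s = 5 * (s div 5) + 2 \<or> s = 5 * (s div 5) + 3" using s mult_div_mod_eq[of 5 s] by metis
  ultimately show "s \<in> rr_parts n" unfolding rr_parts_def by blast
qed

lemma prod_rr_parts:
  "(\<Prod>s\<in>rr_parts n. 1 - fps_X ^ s) = (\<Prod>i<n. (1 - fps_X ^ (5 * i + 2)) * (1 - fps_X ^ (5 * i + 3)) :: 'a::comm_ring_1 fps)"
proof -
  have "(\<lambda>i. 5 * i + 2) ` {..<n} \<inter> (\<lambda>i. 5 * i + 3) ` {..<n} = {}"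
  proof safe
    fix i j :: nat assume "5 * i + 2 = 5 * j + 3"
    then have False by presburger
    then show "5 * i + 2 \<in> {}" ..
  qed
  then have "(\<Prod>s\<in>rr_parts n. 1 - fps_X ^ s :: 'a fps)
    = (\<Prod>s\<in>(\<lambda>i. 5 * i + 2) ` {..<n}. 1 - fps_X ^ s) * (\<Prod>s\<in>(\<lambda>i. 5 * i + 3) ` {..<n}. 1 - fps_X ^ s)"
    unfolding rr_parts_def by (intro prod.union_disjoint) auto
  also have "(\<Prod>s\<in>(\<lambda>i. 5 * i + 2) ` {..<n}. 1 - fps_X ^ s :: 'a fps) = (\<Prod>i<n. 1 - fps_X ^ (5 * i + 2))"
    by (subst prod.reindex) (auto simp: inj_on_def)
  also have "(\<Prod>s\<in>(\<lambda>i. 5 * i + 3) ` {..<n}. 1 - fps_X ^ s :: 'a fps) = (\<Prod>i<n. 1 - fps_X ^ (5 * i + 3))"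
    by (subst prod.reindex) (auto simp: inj_on_def)
  finally show ?thesis by (simp only: prod.distrib)
qed

lemma prod_one_minus_X_nth_0:
  assumes "finite S" "0 \<notin> S"
  shows "fps_nth (\<Prod>s\<in>S. 1 - fps_X ^ s :: 'a::field fps) 0 = 1"
  using assms
proof (induction S rule: finite_induct)
  case (insert s S)
  then have "s > 0" by (auto intro: gr0I)
  with insert show ?case by (simp add: fps_mult_nth_0)
qed simp

lemma rogers_ramanujan2':
  assumes n: "4 * L \<le> n"
  shows "eqm L (\<Sum>j\<le>n. fps_X ^ (j * j + j) * inverse (qfac fps_X j))
     (inverse (\<Prod>s\<in>rr_parts n. 1 - fps_X ^ s) :: 'a::field fps)"
proof -
  let ?V = "\<Prod>s\<in>rr_parts n. 1 - fps_X ^ s :: 'a fps"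
  have 0: "fps_nth ?V 0 = 1"
    by (rule prod_one_minus_X_nth_0) (auto simp: rr_parts_def)
  have "?V * inverse ?V = 1"
    by (rule inverse_mult_eq_1') (simp add: 0)
  then have "eqm L (?V * (\<Sum>j\<le>n. fps_X ^ (j * j + j) * inverse (qfac fps_X j))) (?V * inverse ?V)"
    using rogers_ramanujan2[OF n, where ?'a = 'a] unfolding prod_rr_parts by metis
  then show ?thesis by (rule eqm_cancel) (simp add: 0)
qed

section \<open>Comparison of the coefficients of X^N\<close>

theorem theorem2:
  fixes M N k :: nat
  assumes "M \<ge> 1"
    and "[M + 1 = 2] (mod 5) \<or> [M + 1 = 3] (mod 5)"
    and "N \<ge> 1"
  shows "card {xs. partition_of N xs \<and>
                   (\<forall>x\<in>set xs. [x = 2] (mod 5) \<or> [x = 3] (mod 5)) \<and>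
                   count_list xs (M + 1) = k}
       = card {xs \<in> Diff2_star. partition_of N xs \<and>
           ((length xs = 1 \<and>
               (N = (M + 1) * k \<or>
                (\<exists>i. (2 \<le> i \<and> i \<le> M \<or> i = M + 2) \<and> N = (M + 1) * k + i)))
          \<or> (2 \<le> length xs \<and> length xs \<le> M \<and>
               (M + 1) * k \<le> count_list (col_star xs) 1 \<and>
               count_list (col_star xs) 1 \<le> (M + 1) * k + M)
          \<or> (length xs \<ge> M + 1 \<and> count_list (col_star xs) (M + 1) = k))}"
    (is "card ?L = card {xs \<in> Diff2_star. partition_of N xs \<and> ?P xs}")
proof -
  let ?X = "fps_X :: rat fps"
  \<comment> \<open>Large enough for the Rogers-Ramanujan congruence modulo X^(N+1), for M+1 and all
    parts of a partition of N to lie below 5n, and for n to bound the number of parts.\<close>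
  define n where "n = 4 * N + M + 1"
  define E where "E = ?X ^ ((M + 1) * k) * (1 - ?X ^ (M + 1))"
  define t where "t m = ?X ^ (m * m + m) * inverse (qfac ?X m)" for m
  define R where "R m = {xs \<in> Diff2_star. partition_of N xs \<and> length xs = m \<and> ?P xs}" for m

  have M1: "M + 1 \<in> rr_parts n"
    using assms(2) by (auto simp: rr_parts_iff cong_def n_def)
  have "?L = {xs. partition_of N xs \<and> set xs \<subseteq> rr_parts n \<and> (\<forall>s\<in>rr_parts n. count_list xs s \<in> (if s = M + 1 then {k} else UNIV))}"
  proof -
    have "x < 5 * n" if "partition_of N xs" "x \<in> set xs" for x xs
      using that member_le_sum_list[of x xs] by (auto simp: partition_of_def n_def)
    then show ?thesis
      using M1 by (auto simp: rr_parts_iff cong_def subset_iff)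
  qed
  also have "card \<dots> = card (mults (rr_parts n) (\<lambda>s. if s = M + 1 then {k} else UNIV) N)"
    by (rule bij_betw_same_card[OF bij_betw_partitions_mults]) (auto simp: rr_parts_def)
  also have "rat_of_nat \<dots> = fps_nth (\<Prod>s\<in>rr_parts n. part_gf s (if s = M + 1 then {k} else UNIV)) N"
    by (rule conjunct2[OF card_mults]) (auto simp: rr_parts_def)
  also have "(\<Prod>s\<in>rr_parts n. part_gf s (if s = M + 1 then {k} else UNIV)) = E * inverse (\<Prod>s\<in>rr_parts n. 1 - ?X ^ s)"
    unfolding E_def by (rule prod_part_gf_singleton[OF _ M1]) (auto simp: rr_parts_def)
  also have "fps_nth \<dots> N = fps_nth (E * (\<Sum>m\<le>n. t m)) N"
  proof -
    have "eqm N (E * (\<Sum>m\<le>n. t m)) (E * inverse (\<Prod>s\<in>rr_parts n. 1 - ?X ^ s))"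
      unfolding t_def by (rule eqm_mult[OF eqm_refl rogers_ramanujan2']) (simp add: n_def)
    then show ?thesis by (simp add: eqm_def)
  qed
  also have "\<dots> = (\<Sum>m\<le>n. fps_nth (E * t m) N)"
    by (simp only: sum_distrib_left fps_sum_nth)
  finally have lhs: "rat_of_nat (card ?L) = (\<Sum>m\<le>n. fps_nth (E * t m) N)" .

  have R: "rat_of_nat (card (R m)) = fps_nth (E * t m) N" if "m \<ge> 2" for m
  proof -
    \<comment> \<open>For at least two parts, conditions (2) and (3) restrict the multiplicity of a
      single column length: 1 if m <= M, and M+1 otherwise.\<close>
    define A where "A s = (if m \<le> M then if s = 1 then {(M + 1) * k..(M + 1) * k + M} else UNIV
       else if s = M + 1 then {k} else UNIV)" for s
    have "?P xs \<longleftrightarrow> (\<forall>s\<in>{1..m}. count_list (col_star xs) s \<in> A s)" if "length xs = m" for xs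
      using that \<open>m \<ge> 2\<close> by (cases "m \<le> M") (auto simp: A_def)
    then have "R m = {xs \<in> Diff2_star. partition_of N xs \<and> length xs = m \<and> (\<forall>s\<in>{1..m}. count_list (col_star xs) s \<in> A s)}"
      unfolding R_def by blast
    then have "rat_of_nat (card (R m)) = fps_nth (?X ^ (m * m + m) * (\<Prod>s\<in>{1..m}. part_gf s (A s))) N"
      by (simp only: card_stair_class)
    also have "(\<Prod>s\<in>{1..m}. part_gf s (A s)) = E * inverse (qfac ?X m)"
    proof (cases "m \<le> M")
      case True
      then show ?thesis
        using prod_part_gf_interval[of "{1..m}" "(M + 1) * k" M, where ?'a = rat] that
        by (simp add: A_def E_def qfac_X_alt)
    next
      case False
      then show ?thesis
        using prod_part_gf_singleton[of "{1..m}" "M + 1" k, where ?'a = rat] that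
        by (simp add: A_def E_def qfac_X_alt)
    qed
    finally show ?thesis by (simp add: t_def mult_ac)
  qed

  \<comment> \<open>The terms m = 0 and m = 1 add up to X^((M+1)k) times 1 - X^(M+1) + X^2 (1 + ...
    + X^M). Here X^(M+1) cancels, leaving the offsets 0, 2, ..., M and M+2 of condition (1).\<close>
  have R1: "rat_of_nat (card (R 1)) = fps_nth (E * t 0) N + fps_nth (E * t 1) N"
  proof -
    define Q where "Q \<longleftrightarrow> N = (M + 1) * k \<or> (\<exists>i. (2 \<le> i \<and> i \<le> M \<or> i = M + 2) \<and> N = (M + 1) * k + i)"
    have ne1: "N \<noteq> 1" if Q
    proof
      assume "N = 1"
      with that assms(1) show False by (cases k) (auto simp: Q_def)
    qed
    have "R 1 = (if Q then {[N]} else {})"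
    proof -
      have P: "?P xs \<longleftrightarrow> Q" if "length xs = 1" for xs
        using that assms(1) unfolding Q_def by simp
      have eq: "R 1 = {xs \<in> Diff2_star. partition_of N xs \<and> length xs = 1 \<and> Q}"
        unfolding R_def using P by blast
      show ?thesis
      proof (cases Q)
        case True
        have "[N] \<in> R 1"
          using ne1[OF True] True assms(3) unfolding eq
          by (simp add: Diff2_star_def Diff2_def is_partition_def partition_of_def)
        moreover have "xs = [N]" if "xs \<in> R 1" for xs
          using that unfolding eq by (auto simp: partition_of_def length_Suc_conv)
        ultimately have "R 1 = {[N]}" by blast
        with True show ?thesis by simp
      next
        case False
        then show ?thesis unfolding eq by simp
      qed
    qed
    then have "rat_of_nat (card (R 1)) = (if Q then 1 else 0)" by simp
    also have "\<dots> = fps_nth (?X ^ ((M + 1) * k) * (1 - ?X ^ (M + 1) + ?X ^ 2 * part_gf 1 {0..0 + M})) N"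
    proof -
      consider "N < (M + 1) * k" | i where "N = (M + 1) * k + i" by (metis le_Suc_ex not_le)
      then show ?thesis
      proof cases
        case 1
        then show ?thesis by (auto simp: Q_def fps_X_power_mult_nth)
      next
        case 2
        then have "Q \<longleftrightarrow> i = 0 \<or> (2 \<le> i \<and> i \<le> M \<or> i = M + 2)" by (auto simp: Q_def)
        then show ?thesis using 2 assms(1)
          by (auto simp: fps_X_power_mult_nth fps_X_power_nth part_gf_def)
      qed
    qed
    also have "?X ^ ((M + 1) * k) * (1 - ?X ^ (M + 1) + ?X ^ 2 * part_gf 1 {0..0 + M}) = E * t 0 + E * t 1"
    proof -
      have "part_gf 1 {0..0 + M} * (1 - ?X) * inverse (1 - ?X) = (1 - ?X ^ (M + 1)) * inverse (1 - ?X)"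
        unfolding part_gf_interval by simp
      moreover have "(1 - ?X) * inverse (1 - ?X) = 1" by (rule inverse_mult_eq_1') simp
      ultimately have gf: "part_gf 1 {0..0 + M} = (1 - ?X ^ (M + 1)) * inverse (1 - ?X)"
        by (simp only: mult.assoc mult_1_right)
      have t: "t 0 = 1" "t 1 = ?X ^ 2 * inverse (1 - ?X)"
        by (simp_all add: t_def power2_eq_square)
      show ?thesis
        unfolding E_def t gf by (simp only: distrib_left mult_1_left mult_1_right mult_ac)
    qed
    finally show ?thesis by simp
  qed

  have "{xs \<in> Diff2_star. partition_of N xs \<and> ?P xs} = (\<Union>m\<in>{1..n}. R m)"
  proof -
    have "length xs \<le> n" if "partition_of N xs" for xs
    proof -
      have "length ys \<le> sum_list ys" if "\<forall>x\<in>set ys. 0 < x" for ys :: "nat list"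
        using that by (induction ys) auto
      then show ?thesis using that by (force simp: partition_of_def n_def)
    qed
    moreover have "1 \<le> length xs" if "?P xs" for xs
      using that assms(1) by auto
    ultimately have "length xs \<in> {1..n}" if "partition_of N xs" "?P xs" for xs
      using that by (simp only: atLeastAtMost_iff)
    then show ?thesis unfolding R_def by blast
  qed
  also have "card \<dots> = (\<Sum>m\<in>{1..n}. card (R m))"
  proof (rule card_UN_disjoint)
    have "R m \<subseteq> {xs. partition_of N xs}" for m
      unfolding R_def by blast
    then show "\<forall>m\<in>{1..n}. finite (R m)"
      using finite_subset[OF _ finite_partition_of] by blast
    show "\<forall>m\<in>{1..n}. \<forall>m'\<in>{1..n}. m \<noteq> m' \<longrightarrow> R m \<inter> R m' = {}"
      unfolding R_def by blast
  qed simp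
  finally have "rat_of_nat (card {xs \<in> Diff2_star. partition_of N xs \<and> ?P xs}) = (\<Sum>m\<in>{1..n}. rat_of_nat (card (R m)))"
    by simp
  \<comment> \<open>The class of one-part partitions pays for the terms m = 0 and m = 1, so the
    classes 1..n account for all terms 0..n.\<close>
  also have "{1..n} = insert 1 {2..n}" using assms(1) by (auto simp: n_def)
  also have "(\<Sum>m\<in>insert 1 {2..n}. rat_of_nat (card (R m))) = fps_nth (E * t 0) N + fps_nth (E * t 1) N + (\<Sum>m\<in>{2..n}. fps_nth (E * t m) N)"
    by (simp add: R1[unfolded One_nat_def] R)
  also have "\<dots> = (\<Sum>m\<in>insert 0 (insert 1 {2..n}). fps_nth (E * t m) N)"
    by simp
  also have "insert 0 (insert 1 {2..n}) = {..n}" using assms(1) by (auto simp: n_def)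
  finally show ?thesis
    unfolding lhs[symmetric] of_nat_eq_iff by (rule sym)
qed

end
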